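(* Let $(G,g)$ be a connected Riemannian Lie group with associated Euclidean Lie algebra $(\mathfrak{g},\langle\cdot,\cdot\rangle)$. \begin{enumerate} \item If $\mathfrak{g}=\mathbb{A}_2\oplus 2\mathbb{A}_1$, then $g$ is locally symmetric if and only if there exist an $\langle\cdot,\cdot\rangle$-orthonormal basis $(e_1,e_2,e_3,e_4)$ of $\mathfrak{g}$ and a real number $a>0$ such that the only non-zero structure constant is $C_{12}^{1}=a$. \item If $\mathfrak{g}=\mathbb{A}_{3,1}\oplus\mathbb{A}_1$, then $g$ is not locally symmetric. \item If $\mathfrak{g}=\mathbb{A}_{3,3}\oplus\mathbb{A}_1$, then $g$ is locally symmetric if there exist an $\langle\cdot,\cdot\rangle$-orthonormal basis $(e_1,e_2,e_3,e_4)$ of $\mathfrak{g}$ and a real number $a>0$ such that the only non-zero structure constants are $C_{13}^{1}=C_{23}^{2}=a$. \end{enumerate}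
   Context: A Riemannian Lie group $(G,g)$ is a real Lie group $G$ with a left invariant Riemannian metric $g$; $\mathfrak{g}$ is the Lie algebra of $G$ and $\langle\cdot,\cdot\rangle$ is the inner product on $\mathfrak{g}$ induced by $g$. The pair $(\mathfrak{g},\langle\cdot,\cdot\rangle)$ is the associated Euclidean Lie algebra. Let $\nabla$ be the Levi-Civita connection of $g$ and $R(x,y)=\nabla_{[x,y]}-\nabla_x\nabla_y+\nabla_y\nabla_x$. The metric $g$ is locally symmetric if $\nabla R=0$, equivalently $\nabla_w(R(x,y)z)=R(\nabla_w x,y)z+R(x,\nabla_w y)z+R(x,y)\nabla_w z$ for all $x,y,z,w\in\mathfrak{g}$ (regarded as left invariant vector fields). Structure constants in a basis $(e_i)$ are defined by $[e_i,e_j]=\sum_k C_{ij}^{k}e_k$. In a list of non-zero structure constants, constants not listed vanish, except those determined by $C_{ji}^{k}=-C_{ij}^{k}$. Real Lie algebras, up to isomorphism (unlisted brackets of basis elements vanish): $\mathbb{A}_1=\mathbb{R}$; $2\mathbb{A}_1=\mathbb{A}_1\oplus\mathbb{A}_1=\mathbb{R}^2$; $\mathbb{A}_2$ is the $2$-dimensional non-abelian Lie algebra; $\mathbb{A}_{3,1}$ is the Heisenberg algebra, $[f_2,f_3]=f_1$; $\mathbb{A}_{3,3}$ is given by $[f_1,f_3]=f_1$, $[f_2,f_3]=f_2$. Here $\oplus$ is the direct sum of Lie algebras, and an equality such as $\mathfrak{g}=\mathbb{A}_2\oplus 2\mathbb{A}_1$ means that $\mathfrak{g}$ is isomorphic to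 this Lie algebra; the inner product on $\mathfrak{g}$ is arbitrary. *)

theory Defs
  imports "HOL-Analysis.Analysis" "HOL-Library.Function_Algebras"
begin

section \<open>Smooth maps between open subsets of Euclidean spaces\<close>

text \<open>For open \<open>S\<close>: \<open>f\<close> is of class \<open>C^k\<close> on \<open>S\<close>, by iterating directional derivatives.\<close>

primrec higher_differentiable_on ::
  "nat \<Rightarrow> 'a::euclidean_space set \<Rightarrow> ('a \<Rightarrow> 'b::euclidean_space) \<Rightarrow> bool" where
  "higher_differentiable_on 0 S f \<longleftrightarrow> continuous_on S f"
| "higher_differentiable_on (Suc k) S f \<longleftrightarrow>
     (\<forall>x\<in>S. f differentiable (at x)) \<and>
     (\<forall>v. higher_differentiable_on k S (\<lambda>x. frechet_derivative f (at x) v))"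

definition smooth_on ::
  "'a::euclidean_space set \<Rightarrow> ('a \<Rightarrow> 'b::euclidean_space) \<Rightarrow> bool" where
  "smooth_on S f \<longleftrightarrow> (\<forall>k. higher_differentiable_on k S f)"


section \<open>Smooth manifolds\<close>

text \<open>The underlying space of a manifold is a whole type. A chart \<open>(U, \<phi>)\<close> consists of an open
  set \<open>U\<close> and a map that matters only on \<open>U\<close>. Atlases are not required to be maximal.\<close>

type_synonym ('m, 'e) atlas = "('m set \<times> ('m \<Rightarrow> 'e)) set"

definition smooth_manifold ::
  "('m::{t2_space,second_countable_topology}, 'e::euclidean_space) atlas \<Rightarrow> bool" where
  "smooth_manifold A \<longleftrightarrow>
     (\<forall>(U, \<phi>)\<in>A. open U \<and> open (\<phi> ` U) \<and> homeomorphism U (\<phi> ` U) \<phi> (inv_into U \<phi>)) \<and>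
     (\<Union>(U, \<phi>)\<in>A. U) = UNIV \<and>
     (\<forall>(U, \<phi>)\<in>A. \<forall>(V, \<psi>)\<in>A. smooth_on (\<phi> ` (U \<inter> V)) (\<psi> \<circ> inv_into U \<phi>))"

definition std_atlas :: "('e::euclidean_space, 'e) atlas" where
  "std_atlas = {(UNIV, id)}"

definition prod_atlas ::
  "('m, 'd) atlas \<Rightarrow> ('n, 'e) atlas \<Rightarrow> ('m \<times> 'n, 'd \<times> 'e) atlas" where
  "prod_atlas A B = {(U \<times> V, map_prod \<phi> \<psi>) | U \<phi> V \<psi>. (U, \<phi>) \<in> A \<and> (V, \<psi>) \<in> B}"

definition smooth_map ::
  "('m::topological_space, 'd::euclidean_space) atlas \<Rightarrow>
   ('n::topological_space, 'e::euclidean_space) atlas \<Rightarrow> 'm set \<Rightarrow> ('m \<Rightarrow> 'n) \<Rightarrow> bool" where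
  "smooth_map A B S f \<longleftrightarrow> continuous_on S f \<and>
     (\<forall>(U, \<phi>)\<in>A. \<forall>(V, \<psi>)\<in>B.
        smooth_on (\<phi> ` (U \<inter> S \<inter> f -` V)) (\<psi> \<circ> f \<circ> inv_into U \<phi>))"

definition smooth_functions ::
  "('m::topological_space, 'e::euclidean_space) atlas \<Rightarrow> ('m \<Rightarrow> real) set" where
  "smooth_functions A = {f. smooth_map A std_atlas UNIV f}"


section \<open>Tangent vectors and vector fields\<close>

text \<open>A tangent vector is the velocity at time \<open>0\<close> of a smooth curve \<open>c\<close>, viewed as the functional
  sending a smooth \<open>f\<close> to the derivative of \<open>f \<circ> c\<close> at \<open>0\<close>. Functionals are set to \<open>0\<close> on
  non-smooth functions, so that equality of HOL functions is equality of tangent vectors.\<close>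

type_synonym 'm tangent = "('m \<Rightarrow> real) \<Rightarrow> real"
type_synonym 'm vfield = "'m \<Rightarrow> 'm tangent"

definition velocity ::
  "('m::topological_space, 'e::euclidean_space) atlas \<Rightarrow> (real \<Rightarrow> 'm) \<Rightarrow> 'm tangent" where
  "velocity A c = (\<lambda>f. if f \<in> smooth_functions A then deriv (f \<circ> c) 0 else 0)"

definition tangent_space ::
  "('m::topological_space, 'e::euclidean_space) atlas \<Rightarrow> 'm \<Rightarrow> 'm tangent set" where
  "tangent_space A p =
     {velocity A c | c. c 0 = p \<and> (\<exists>\<epsilon>>0. smooth_map std_atlas A {-\<epsilon><..<\<epsilon>} c)}"

definition app :: "'m vfield \<Rightarrow> ('m \<Rightarrow> real) \<Rightarrow> 'm \<Rightarrow> real" where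
  "app X f = (\<lambda>p. X p f)"

definition vector_fields ::
  "('m::topological_space, 'e::euclidean_space) atlas \<Rightarrow> 'm vfield set" where
  "vector_fields A = {X. (\<forall>p. X p \<in> tangent_space A p) \<and>
     (\<forall>f\<in>smooth_functions A. app X f \<in> smooth_functions A)}"

text \<open>Sums and differences of vector fields are the pointwise ones of \<open>Function_Algebras\<close>.\<close>

definition fmult :: "('m \<Rightarrow> real) \<Rightarrow> 'm vfield \<Rightarrow> 'm vfield" where
  "fmult h X = (\<lambda>p f. h p * X p f)"

definition cmult :: "real \<Rightarrow> 'm vfield \<Rightarrow> 'm vfield" where
  "cmult r X = (\<lambda>p f. r * X p f)"

definition bracket :: "'m vfield \<Rightarrow> 'm vfield \<Rightarrow> 'm vfield" where
  "bracket X Y = (\<lambda>p f. X p (app Y f) - Y p (app X f))"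


section \<open>Riemannian metrics, the Levi-Civita connection and local symmetry\<close>

type_synonym 'm metric_tensor = "'m \<Rightarrow> 'm tangent \<Rightarrow> 'm tangent \<Rightarrow> real"

definition inner_product_on :: "'m tangent set \<Rightarrow> ('m tangent \<Rightarrow> 'm tangent \<Rightarrow> real) \<Rightarrow> bool" where
  "inner_product_on T b \<longleftrightarrow>
     (\<forall>u\<in>T. \<forall>v\<in>T. b u v = b v u) \<and>
     (\<forall>u\<in>T. \<forall>v\<in>T. \<forall>w\<in>T. b (u + v) w = b u w + b v w) \<and>
     (\<forall>r. \<forall>u\<in>T. \<forall>v\<in>T. b (\<lambda>f. r * u f) v = r * b u v) \<and>
     (\<forall>u\<in>T. u \<noteq> 0 \<longrightarrow> b u u > 0)"

definition pair_fields :: "'m metric_tensor \<Rightarrow> 'm vfield \<Rightarrow> 'm vfield \<Rightarrow> 'm \<Rightarrow> real" where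
  "pair_fields g X Y = (\<lambda>p. g p (X p) (Y p))"

definition riemannian_metric ::
  "('m::topological_space, 'e::euclidean_space) atlas \<Rightarrow> 'm metric_tensor \<Rightarrow> bool" where
  "riemannian_metric A g \<longleftrightarrow>
     (\<forall>p. inner_product_on (tangent_space A p) (g p)) \<and>
     (\<forall>X\<in>vector_fields A. \<forall>Y\<in>vector_fields A. pair_fields g X Y \<in> smooth_functions A)"

type_synonym 'm connection = "'m vfield \<Rightarrow> 'm vfield \<Rightarrow> 'm vfield"

definition affine_connection ::
  "('m::topological_space, 'e::euclidean_space) atlas \<Rightarrow> 'm connection \<Rightarrow> bool" where
  "affine_connection A D \<longleftrightarrow>
     (\<forall>X\<in>vector_fields A. \<forall>Y\<in>vector_fields A. D X Y \<in> vector_fields A) \<and>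
     (\<forall>X\<in>vector_fields A. \<forall>X'\<in>vector_fields A. \<forall>Y\<in>vector_fields A.
        D (X + X') Y = D X Y + D X' Y) \<and>
     (\<forall>h\<in>smooth_functions A. \<forall>X\<in>vector_fields A. \<forall>Y\<in>vector_fields A.
        D (fmult h X) Y = fmult h (D X Y)) \<and>
     (\<forall>X\<in>vector_fields A. \<forall>Y\<in>vector_fields A. \<forall>Y'\<in>vector_fields A.
        D X (Y + Y') = D X Y + D X Y') \<and>
     (\<forall>h\<in>smooth_functions A. \<forall>X\<in>vector_fields A. \<forall>Y\<in>vector_fields A.
        D X (fmult h Y) = fmult h (D X Y) + fmult (app X h) Y)"

definition levi_civita ::
  "('m::topological_space, 'e::euclidean_space) atlas \<Rightarrow> 'm metric_tensor \<Rightarrow> 'm connection \<Rightarrow> bool"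
  where
  "levi_civita A g D \<longleftrightarrow> affine_connection A D \<and>
     (\<forall>X\<in>vector_fields A. \<forall>Y\<in>vector_fields A. D X Y - D Y X = bracket X Y) \<and>
     (\<forall>X\<in>vector_fields A. \<forall>Y\<in>vector_fields A. \<forall>Z\<in>vector_fields A.
        app X (pair_fields g Y Z) = pair_fields g (D X Y) Z + pair_fields g Y (D X Z))"

definition curvature :: "'m connection \<Rightarrow> 'm vfield \<Rightarrow> 'm vfield \<Rightarrow> 'm vfield \<Rightarrow> 'm vfield" where
  "curvature D X Y Z = D (bracket X Y) Z - D X (D Y Z) + D Y (D X Z)"

text \<open>\<open>D\<close> is meant to be the Levi-Civita connection of the metric under consideration; the condition
  says that the covariant derivative of its curvature tensor vanishes.\<close>

definition locally_symmetric ::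
  "('m::topological_space, 'e::euclidean_space) atlas \<Rightarrow> 'm connection \<Rightarrow> bool" where
  "locally_symmetric A D \<longleftrightarrow>
     (\<forall>W\<in>vector_fields A. \<forall>X\<in>vector_fields A. \<forall>Y\<in>vector_fields A. \<forall>Z\<in>vector_fields A.
        D W (curvature D X Y Z) =
          curvature D (D W X) Y Z + curvature D X (D W Y) Z + curvature D X Y (D W Z))"


section \<open>Riemannian Lie groups and their Euclidean Lie algebras\<close>

definition lie_group ::
  "('g::{t2_space,second_countable_topology}, 'e::euclidean_space) atlas \<Rightarrow>
   ('g \<Rightarrow> 'g \<Rightarrow> 'g) \<Rightarrow> 'g \<Rightarrow> ('g \<Rightarrow> 'g) \<Rightarrow> bool" where
  "lie_group A mul e iv \<longleftrightarrow> smooth_manifold A \<and> group mul e iv \<and>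
     smooth_map (prod_atlas A A) A UNIV (\<lambda>(a, b). mul a b) \<and> smooth_map A A UNIV iv"

text \<open>The differential of left translation by \<open>a\<close>, on tangent vectors at an arbitrary point.\<close>

definition push_left :: "('g \<Rightarrow> 'g \<Rightarrow> 'g) \<Rightarrow> 'g \<Rightarrow> 'g tangent \<Rightarrow> 'g tangent" where
  "push_left mul a v = (\<lambda>f. v (\<lambda>q. f (mul a q)))"

definition left_invariant_metric ::
  "('g::topological_space, 'e::euclidean_space) atlas \<Rightarrow> ('g \<Rightarrow> 'g \<Rightarrow> 'g) \<Rightarrow>
   'g metric_tensor \<Rightarrow> bool" where
  "left_invariant_metric A mul g \<longleftrightarrow>
     (\<forall>a p. \<forall>u\<in>tangent_space A p. \<forall>v\<in>tangent_space A p.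
        g (mul a p) (push_left mul a u) (push_left mul a v) = g p u v)"

definition riemannian_lie_group ::
  "('g::{t2_space,second_countable_topology}, 'e::euclidean_space) atlas \<Rightarrow>
   ('g \<Rightarrow> 'g \<Rightarrow> 'g) \<Rightarrow> 'g \<Rightarrow> ('g \<Rightarrow> 'g) \<Rightarrow> 'g metric_tensor \<Rightarrow> bool" where
  "riemannian_lie_group A mul e iv g \<longleftrightarrow>
     lie_group A mul e iv \<and> riemannian_metric A g \<and> left_invariant_metric A mul g"

text \<open>The Lie algebra consists of the left invariant vector fields, with \<open>bracket\<close>.\<close>

definition lie_algebra ::
  "('g::topological_space, 'e::euclidean_space) atlas \<Rightarrow> ('g \<Rightarrow> 'g \<Rightarrow> 'g) \<Rightarrow> 'g vfield set" where
  "lie_algebra A mul =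
     {X \<in> vector_fields A. \<forall>a p. X (mul a p) = push_left mul a (X p)}"

definition lie_inner :: "'g metric_tensor \<Rightarrow> 'g \<Rightarrow> 'g vfield \<Rightarrow> 'g vfield \<Rightarrow> real" where
  "lie_inner g e X Y = g e (X e) (Y e)"

text \<open>\<open>b 1, \<dots>, b n\<close> is an orthonormal basis of the real vector space \<open>L\<close>.\<close>

definition orthonormal_basis ::
  "('g vfield \<Rightarrow> 'g vfield \<Rightarrow> real) \<Rightarrow> 'g vfield set \<Rightarrow> nat \<Rightarrow> (nat \<Rightarrow> 'g vfield) \<Rightarrow> bool" where
  "orthonormal_basis ip L n b \<longleftrightarrow>
     (\<forall>i\<in>{1..n}. b i \<in> L) \<and>
     (\<forall>x\<in>L. \<exists>!c. c \<in> {1..n} \<rightarrow>\<^sub>E UNIV \<and> x = (\<Sum>i=1..n. cmult (c i) (b i))) \<and>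
     (\<forall>i\<in>{1..n}. \<forall>j\<in>{1..n}. ip (b i) (b j) = (if i = j then 1 else 0))"

definition structure_constants ::
  "nat \<Rightarrow> (nat \<Rightarrow> 'g vfield) \<Rightarrow> (nat \<Rightarrow> nat \<Rightarrow> nat \<Rightarrow> real) \<Rightarrow> bool" where
  "structure_constants n b C \<longleftrightarrow>
     (\<forall>i\<in>{1..n}. \<forall>j\<in>{1..n}. bracket (b i) (b j) = (\<Sum>k=1..n. cmult (C i j k) (b k)))"

text \<open>Completes a list of structure constants (given as a function that is \<open>0\<close> on the unlisted
  index triples and on triples with \<open>i \<ge> j\<close>) by skew-symmetry in the lower indices.\<close>

definition skew :: "(nat \<Rightarrow> nat \<Rightarrow> nat \<Rightarrow> real) \<Rightarrow> nat \<Rightarrow> nat \<Rightarrow> nat \<Rightarrow> real" where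
  "skew C i j k = C i j k - C j i k"


section \<open>The model Lie algebras\<close>

text \<open>A model Lie algebra is the bracket on a real vector space, written in coordinates with
  respect to the basis \<open>f\<^sub>1, f\<^sub>2, \<dots>\<close>.\<close>

type_synonym 'v lie_bracket = "'v \<Rightarrow> 'v \<Rightarrow> 'v"

definition direct_sum :: "'v lie_bracket \<Rightarrow> 'w lie_bracket \<Rightarrow> ('v \<times> 'w) lie_bracket"
    (infixr "\<oplus>\<^sub>L" 65) where
  "direct_sum B B' = (\<lambda>(x, y) (x', y'). (B x x', B' y y'))"

definition A1 :: "real lie_bracket" where
  "A1 = (\<lambda>x y. 0)"

text \<open>The \<open>2\<close>-dimensional non-abelian Lie algebra: \<open>[f\<^sub>1, f\<^sub>2] = f\<^sub>1\<close>.\<close>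

definition A2 :: "(real \<times> real) lie_bracket" where
  "A2 = (\<lambda>(x1, x2) (y1, y2). (x1 * y2 - x2 * y1, 0))"

text \<open>\<open>[f\<^sub>2, f\<^sub>3] = f\<^sub>1\<close>\<close>

definition A31 :: "(real \<times> real \<times> real) lie_bracket" where
  "A31 = (\<lambda>(x1, x2, x3) (y1, y2, y3). (x2 * y3 - x3 * y2, 0, 0))"

text \<open>\<open>[f\<^sub>1, f\<^sub>3] = f\<^sub>1\<close> and \<open>[f\<^sub>2, f\<^sub>3] = f\<^sub>2\<close>\<close>

definition A33 :: "(real \<times> real \<times> real) lie_bracket" where
  "A33 = (\<lambda>(x1, x2, x3) (y1, y2, y3). (x1 * y3 - x3 * y1, x2 * y3 - x3 * y2, 0))"

definition lie_isomorphic :: "'g vfield set \<Rightarrow> 'v::real_vector lie_bracket \<Rightarrow> bool" where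
  "lie_isomorphic L B \<longleftrightarrow>
     (\<exists>\<Phi>. bij_betw \<Phi> UNIV L \<and>
        (\<forall>x y. \<Phi> (x + y) = \<Phi> x + \<Phi> y) \<and>
        (\<forall>r x. \<Phi> (r *\<^sub>R x) = cmult r (\<Phi> x)) \<and>
        (\<forall>x y. \<Phi> (B x y) = bracket (\<Phi> x) (\<Phi> y)))"

end

theory Submission
  imports Defs
begin

text \<open>Every tangent vector at \<open>e\<close> extends to a left invariant vector field, so an orthonormal
  basis of the Lie algebra is a global frame. On left invariant fields the Levi-Civita connection
  is an algebraic product given by Koszul's formula, and since \<open>\<nabla>R\<close> is tensorial, local symmetry
  is a polynomial identity in the structure constants. For \<open>A2 \<oplus> 2A1\<close> and \<open>A31 \<oplus> A1\<close>, all brackets are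
  multiples of one vector \<open>f\<^sub>1\<close>, and the Gram-Schmidt process applied to a basis that starts with
  \<open>f\<^sub>1\<close> leaves three and one structure constants, respectively. For these, a single component of
  \<open>\<nabla>R\<close> is decisive.\<close>

section \<open>Calculus of smooth maps on open sets\<close>

text \<open>A tangent space is given as a set of velocities of curves, so at the outset tangent
  vectors cannot be added and obey no product rule. Addition comes from the isomorphism with a model
  algebra: it makes the left invariant fields a vector space, and evaluation at any point maps them
  onto the tangent space there. The product rule is bypassed: the laws of the bracket are read off
  from \<open>D\<close>, whose torsion vanishes. The analytic core is then one statement, that the
  \<open>t\<close>-derivative at 0 of \<open>f (mul p (c t))\<close> is smooth in \<open>p\<close>;
  it makes left invariant extensions smooth. Gram-Schmidt preserves a flag, and the flag is chosen
  to fit the bracket: derived algebra first, then further central directions, and last the vectors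
  on which the bracket is not trivial. Hence the inner product can disturb few structure constants.
  The components of \<nabla>R tested later are (a^2/2)(b e3 + c e4) for the first algebra and
  (a^3/2) e3 for the second. The surviving metrics are locally products of a flat factor with a
  space of constant curvature -a^2, of dimension 2 or 3.\<close>

lemma higher_differentiable_on_subset:
  "\<lbrakk>higher_differentiable_on k S f; T \<subseteq> S\<rbrakk> \<Longrightarrow> higher_differentiable_on k T f"
proof (induction k arbitrary: f)
  case 0
  then show ?case using continuous_on_subset by auto
next
  case (Suc k)
  then show ?case by (auto simp: subset_iff)
qed

lemma frechet_derivative_cong_open:
  assumes "open S" "x \<in> S" "\<And>y. y \<in> S \<Longrightarrow> f y = g y"
  shows "f differentiable (at x) \<longleftrightarrow> g differentiable (at x)"
    and "frechet_derivative f (at x) = frechet_derivative g (at x)"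
proof -
  have "(f has_derivative D) (at x) \<longleftrightarrow> (g has_derivative D) (at x)" for D
    using has_derivative_transform_within_open[OF _ assms(1,2), of f D UNIV g]
      has_derivative_transform_within_open[OF _ assms(1,2), of g D UNIV f] assms(3) by force
  then show "f differentiable (at x) \<longleftrightarrow> g differentiable (at x)"
    and "frechet_derivative f (at x) = frechet_derivative g (at x)"
    by (auto simp: differentiable_def frechet_derivative_def)
qed

lemma higher_differentiable_on_cong:
  assumes "open S" "\<And>y. y \<in> S \<Longrightarrow> f y = g y"
  shows "higher_differentiable_on k S f \<longleftrightarrow> higher_differentiable_on k S g"
  using assms(2)
proof (induction k arbitrary: f g)
  case 0
  then show ?case using continuous_on_cong by fastforce
next
  case (Suc k)
  have "higher_differentiable_on k S (\<lambda>x. frechet_derivative f (at x) v)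
     \<longleftrightarrow> higher_differentiable_on k S (\<lambda>x. frechet_derivative g (at x) v)" for v
    using Suc.IH frechet_derivative_cong_open(2)[OF \<open>open S\<close>, of _ f g] Suc.prems by presburger
  then show ?case
    using frechet_derivative_cong_open(1)[OF \<open>open S\<close>, of _ f g] Suc.prems by auto
qed

text \<open>Derivatives are taken at full neighbourhoods of a point and do not see the set. Only
  continuity within \<open>S\<close>, the base case, uses that \<open>T\<close> is open.\<close>

lemma higher_differentiable_on_local:
  assumes "\<And>x. x \<in> S \<Longrightarrow> \<exists>T. open T \<and> x \<in> T \<and> higher_differentiable_on k (T \<inter> S) f"
  shows "higher_differentiable_on k S f"
  using assms
proof (induction k arbitrary: f)
  case 0
  have "continuous (at x within S) f" if x: "x \<in> S" for x
  proof -
    obtain T where "open T" "x \<in> T" "continuous_on (T \<inter> S) f"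
      using 0 x by auto
    moreover from this have "at x within T \<inter> S = at x within S"
      by (intro at_within_nhd[of x T]) auto
    ultimately show ?thesis
      using x by (metis IntI continuous_on_eq_continuous_within continuous_within)
  qed
  then show ?case by (simp add: continuous_on_eq_continuous_within)
next
  case (Suc k)
  have "f differentiable at x" if x: "x \<in> S" for x
  proof -
    obtain T where "x \<in> T" "higher_differentiable_on (Suc k) (T \<inter> S) f"
      using Suc.prems[OF x] by blast
    then show ?thesis using x by simp
  qed
  moreover have "higher_differentiable_on k S (\<lambda>x. frechet_derivative f (at x) v)" for v
    by (rule Suc.IH) (use Suc.prems in force)
  ultimately show ?case by simp
qed

lemma higher_differentiable_on_SucD:
  "higher_differentiable_on (Suc k) S f \<Longrightarrow> higher_differentiable_on k S f"
proof (induction k arbitrary: f)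
  case 0
  then show ?case
    by (auto intro!: differentiable_imp_continuous_on
        simp: differentiable_on_def differentiable_at_withinI)
next
  case (Suc k)
  then show ?case by simp
qed

lemma higher_differentiable_on_const: "higher_differentiable_on k S (\<lambda>x. c)"
  by (induction k arbitrary: c) auto

text \<open>Any explicit family \<open>D\<close> of derivatives may replace the chosen
  \<open>frechet_derivative\<close>. Together with the elimination rule below, this turns the
  closure properties into inductions on \<open>k\<close> that apply the usual differentiation
  rules.\<close>

lemma higher_differentiable_on_SucI:
  assumes "open S" "\<And>x. x \<in> S \<Longrightarrow> (f has_derivative D x) (at x)"
    "\<And>v. higher_differentiable_on k S (\<lambda>x. D x v)"
  shows "higher_differentiable_on (Suc k) S f"
proof -
  have "frechet_derivative f (at x) = D x" if "x \<in> S" for x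
    using assms(2)[OF that] frechet_derivative_at by metis
  then have "higher_differentiable_on k S (\<lambda>x. frechet_derivative f (at x) v)" for v
    using assms(3)[of v]
    by (subst higher_differentiable_on_cong[OF assms(1), where g="\<lambda>x. D x v"]) auto
  then show ?thesis
    using assms(2) by (auto simp: differentiable_def)
qed

lemma higher_differentiable_on_SucE:
  assumes "higher_differentiable_on (Suc k) S f"
  shows "\<exists>D. (\<forall>x\<in>S. (f has_derivative D x) (at x)) \<and> (\<forall>v. higher_differentiable_on k S (\<lambda>x. D x v))"
  using assms frechet_derivative_works[of f] by auto

lemma higher_differentiable_on_bounded_linear:
  assumes "open S" "bounded_linear L" "higher_differentiable_on k S f"
  shows "higher_differentiable_on k S (\<lambda>x. L (f x))"
  using assms(3)
proof (induction k arbitrary: f)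
  case 0
  then show ?case
    using bounded_linear.continuous_on[OF assms(2)] by simp
next
  case (Suc k)
  obtain D where D: "\<And>x. x \<in> S \<Longrightarrow> (f has_derivative D x) (at x)"
    "\<And>v. higher_differentiable_on k S (\<lambda>x. D x v)"
    using higher_differentiable_on_SucE[OF Suc.prems] by blast
  show ?case
    by (rule higher_differentiable_on_SucI[OF assms(1), where D="\<lambda>x v. L (D x v)"])
      (auto intro!: Suc.IH D bounded_linear.has_derivative[OF assms(2)])
qed

lemma higher_differentiable_on_add:
  assumes "open S" "higher_differentiable_on k S f" "higher_differentiable_on k S g"
  shows "higher_differentiable_on k S (\<lambda>x. f x + g x)"
  using assms(2,3)
proof (induction k arbitrary: f g)
  case 0
  then show ?case by (simp add: continuous_on_add)
next
  case (Suc k)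
  obtain D where D: "\<And>x. x \<in> S \<Longrightarrow> (f has_derivative D x) (at x)"
    "\<And>v. higher_differentiable_on k S (\<lambda>x. D x v)"
    using higher_differentiable_on_SucE[OF Suc.prems(1)] by blast
  obtain D' where D': "\<And>x. x \<in> S \<Longrightarrow> (g has_derivative D' x) (at x)"
    "\<And>v. higher_differentiable_on k S (\<lambda>x. D' x v)"
    using higher_differentiable_on_SucE[OF Suc.prems(2)] by blast
  show ?case
    by (rule higher_differentiable_on_SucI[OF assms(1), where D="\<lambda>x v. D x v + D' x v"])
      (auto intro!: Suc.IH D D' has_derivative_add)
qed

lemma higher_differentiable_on_sum:
  assumes "open S" "\<And>i. i \<in> I \<Longrightarrow> higher_differentiable_on k S (f i)"
  shows "higher_differentiable_on k S (\<lambda>x. \<Sum>i\<in>I. f i x)"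
  using assms(2)
  by (induction I rule: infinite_finite_induct)
    (auto intro: higher_differentiable_on_const higher_differentiable_on_add[OF assms(1)])

lemma higher_differentiable_on_bilinear:
  assumes "open S" "bounded_bilinear B" "higher_differentiable_on k S f" "higher_differentiable_on k S g"
  shows "higher_differentiable_on k S (\<lambda>x. B (f x) (g x))"
  using assms(3,4)
proof (induction k arbitrary: f g)
  case 0
  then show ?case by (simp add: bounded_bilinear.continuous_on[OF assms(2)])
next
  case (Suc k)
  obtain D where D: "\<And>x. x \<in> S \<Longrightarrow> (f has_derivative D x) (at x)"
    "\<And>v. higher_differentiable_on k S (\<lambda>x. D x v)"
    using higher_differentiable_on_SucE[OF Suc.prems(1)] by blast
  obtain D' where D': "\<And>x. x \<in> S \<Longrightarrow> (g has_derivative D' x) (at x)"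
    "\<And>v. higher_differentiable_on k S (\<lambda>x. D' x v)"
    using higher_differentiable_on_SucE[OF Suc.prems(2)] by blast
  show ?case
    by (rule higher_differentiable_on_SucI[OF assms(1),
          where D="\<lambda>x v. B (f x) (D' x v) + B (D x v) (g x)"])
      (auto intro!: Suc.IH D D' higher_differentiable_on_add[OF assms(1)]
        bounded_bilinear.FDERIV[OF assms(2)] Suc.prems[THEN higher_differentiable_on_SucD])
qed

lemma higher_differentiable_on_compose:
  assumes "open S" "higher_differentiable_on k S f" "higher_differentiable_on k T g" "f ` S \<subseteq> T"
  shows "higher_differentiable_on k S (\<lambda>x. g (f x))"
  using assms(2,3)
proof (induction k arbitrary: g)
  case 0
  then show ?case using assms(4) continuous_on_compose2 by auto
next
  case (Suc k)
  obtain D where D: "\<And>x. x \<in> S \<Longrightarrow> (f has_derivative D x) (at x)"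
    "\<And>v. higher_differentiable_on k S (\<lambda>x. D x v)"
    using higher_differentiable_on_SucE[OF Suc.prems(1)] by blast
  obtain D' where D': "\<And>x. x \<in> T \<Longrightarrow> (g has_derivative D' x) (at x)"
    "\<And>v. higher_differentiable_on k T (\<lambda>x. D' x v)"
    using higher_differentiable_on_SucE[OF Suc.prems(2)] by blast
  \<comment> \<open>In the chain rule the direction \<open>D x v\<close> varies with
    \<open>x\<close>, whereas regularity of \<open>D'\<close> is known for fixed directions.
    Expanding in \<open>Basis\<close> moves the variation into scalar coefficients.\<close>
  have "D' (f x) (D x v) = (\<Sum>b\<in>Basis. (D x v \<bullet> b) *\<^sub>R D' (f x) b)" if "x \<in> S" for x v
  proof -
    have l: "linear (D' (f x))"
      using D' assms(4) that by (blast intro: has_derivative_linear)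
    have "D' (f x) (D x v) = D' (f x) (\<Sum>b\<in>Basis. (D x v \<bullet> b) *\<^sub>R b)"
      by (simp add: euclidean_representation)
    then show ?thesis by (simp add: linear_sum[OF l] linear_scale[OF l])
  qed
  moreover have "higher_differentiable_on k S (\<lambda>x. \<Sum>b\<in>Basis. (D x v \<bullet> b) *\<^sub>R D' (f x) b)" for v
    by (intro higher_differentiable_on_sum[OF assms(1)] Suc.IH D' D
        higher_differentiable_on_SucD[OF Suc.prems(1)]
        higher_differentiable_on_bilinear[OF assms(1) bounded_bilinear_scaleR]
        higher_differentiable_on_bounded_linear[OF assms(1) bounded_linear_inner_left])
  ultimately have "higher_differentiable_on k S (\<lambda>x. D' (f x) (D x v))" for v
    by (subst higher_differentiable_on_cong[OF assms(1)]) auto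
  moreover have "((\<lambda>x. g (f x)) has_derivative (\<lambda>v. D' (f x) (D x v))) (at x)" if "x \<in> S" for x
    using diff_chain_at[OF D(1)[OF that] D'(1)] assms(4) that by (auto simp: o_def)
  ultimately show ?case
    by (rule higher_differentiable_on_SucI[OF assms(1), rotated])
qed

section \<open>Closure properties of smooth functions on open sets\<close>

lemma smooth_on_subset: "\<lbrakk>smooth_on S f; T \<subseteq> S\<rbrakk> \<Longrightarrow> smooth_on T f"
  unfolding smooth_on_def using higher_differentiable_on_subset by blast

lemma smooth_on_cong:
  assumes "open S" "\<And>y. y \<in> S \<Longrightarrow> f y = g y"
  shows "smooth_on S f \<longleftrightarrow> smooth_on S g"
  using higher_differentiable_on_cong[OF assms] by (auto simp: smooth_on_def)

lemma smooth_on_local: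
  assumes "\<And>x. x \<in> S \<Longrightarrow> \<exists>T. open T \<and> x \<in> T \<and> smooth_on (T \<inter> S) f"
  shows "smooth_on S f"
  unfolding smooth_on_def
proof
  show "higher_differentiable_on k S f" for k
    by (rule higher_differentiable_on_local) (use assms smooth_on_def in blast)
qed

lemma smooth_on_compose:
  "\<lbrakk>open S; smooth_on S f; smooth_on T g; f ` S \<subseteq> T\<rbrakk> \<Longrightarrow> smooth_on S (\<lambda>x. g (f x))"
  unfolding smooth_on_def using higher_differentiable_on_compose by blast

lemma smooth_on_const: "smooth_on S (\<lambda>x. c)"
  by (simp add: smooth_on_def higher_differentiable_on_const)

lemma smooth_on_bounded_linear:
  assumes "bounded_linear L" shows "smooth_on S L"
proof -
  have "higher_differentiable_on k UNIV L" for k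
  proof (cases k)
    case 0
    then show ?thesis by (simp add: linear_continuous_on assms)
  next
    case (Suc n)
    then show ?thesis
      by (auto intro!: higher_differentiable_on_SucI[where D="\<lambda>x. L"]
          simp del: higher_differentiable_on.simps(2)
          simp: higher_differentiable_on_const bounded_linear_imp_has_derivative assms)
  qed
  then show ?thesis
    unfolding smooth_on_def using higher_differentiable_on_subset by blast
qed

lemma smooth_on_add:
  "\<lbrakk>open S; smooth_on S f; smooth_on S g\<rbrakk> \<Longrightarrow> smooth_on S (\<lambda>x. f x + g x)"
  by (simp add: smooth_on_def higher_differentiable_on_add)

lemma smooth_on_mult:
  fixes f g :: "'a::euclidean_space \<Rightarrow> real"
  shows "\<lbrakk>open S; smooth_on S f; smooth_on S g\<rbrakk> \<Longrightarrow> smooth_on S (\<lambda>x. f x * g x)"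
  by (simp add: smooth_on_def higher_differentiable_on_bilinear[OF _ bounded_bilinear_mult])

lemma smooth_on_Pair:
  assumes "open S" "smooth_on S f" "smooth_on S g"
  shows "smooth_on S (\<lambda>x. (f x, g x))"
proof -
  have "smooth_on S (\<lambda>x. (f x, 0) + (0, g x))"
    by (intro smooth_on_add assms smooth_on_compose[OF assms(1,2), where g="\<lambda>y. (y, 0)" and T=UNIV]
        smooth_on_compose[OF assms(1,3), where g="\<lambda>y. (0, y)" and T=UNIV]
        smooth_on_bounded_linear bounded_linear_Pair bounded_linear_zero bounded_linear_ident) auto
  then show ?thesis by simp
qed

lemma smooth_on_imp_continuous_on: "smooth_on S f \<Longrightarrow> continuous_on S f"
  unfolding smooth_on_def using higher_differentiable_on.simps(1) by blast

lemma smooth_on_imp_differentiable: "\<lbrakk>smooth_on S f; x \<in> S\<rbrakk> \<Longrightarrow> f differentiable (at x)"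
  unfolding smooth_on_def using higher_differentiable_on.simps(2)[of 0] by blast

lemma smooth_on_frechet_derivative:
  assumes "smooth_on S f" shows "smooth_on S (\<lambda>x. frechet_derivative f (at x) v)"
  unfolding smooth_on_def
proof
  show "higher_differentiable_on k S (\<lambda>x. frechet_derivative f (at x) v)" for k
    using assms[unfolded smooth_on_def, rule_format, of "Suc k"] by simp
qed


section \<open>Smooth maps between manifolds\<close>

text \<open>The topological half of \<open>smooth_manifold\<close>. Compositions and pairings rest
  on it alone; compatibility of charts enters through the identity and the two projections. For
  \<open>prod_atlas\<close> it is therefore enough to establish this half.\<close>

definition chart_cover :: "('m::topological_space, 'e::euclidean_space) atlas \<Rightarrow> bool" where
  "chart_cover A \<longleftrightarrow>
     (\<forall>(U, \<phi>)\<in>A. open U \<and> open (\<phi> ` U) \<and> homeomorphism U (\<phi> ` U) \<phi> (inv_into U \<phi>)) \<and>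
     (\<Union>(U, \<phi>)\<in>A. U) = UNIV"

lemma smooth_manifold_chart_cover: "smooth_manifold A \<Longrightarrow> chart_cover A"
  by (simp add: smooth_manifold_def chart_cover_def)

lemma chart_coverD:
  assumes "chart_cover A" "(U, \<phi>) \<in> A"
  shows "open U" "open (\<phi> ` U)" "homeomorphism U (\<phi> ` U) \<phi> (inv_into U \<phi>)" "inj_on \<phi> U"
    "\<And>p. p \<in> U \<Longrightarrow> inv_into U \<phi> (\<phi> p) = p"
proof -
  show h: "open U" "open (\<phi> ` U)" "homeomorphism U (\<phi> ` U) \<phi> (inv_into U \<phi>)"
    using assms by (auto simp: chart_cover_def)
  show "\<And>p. p \<in> U \<Longrightarrow> inv_into U \<phi> (\<phi> p) = p"
    using h(3) homeomorphism_apply1 by blast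
  then show "inj_on \<phi> U" by (rule inj_on_inverseI)
qed

lemma chart_cover_obtain:
  assumes "chart_cover A" obtains U \<phi> where "(U, \<phi>) \<in> A" "p \<in> U"
proof -
  have "p \<in> (\<Union>(U, \<phi>)\<in>A. U)" using assms by (simp add: chart_cover_def)
  then show ?thesis using that by auto
qed

lemma chart_image_open:
  assumes "chart_cover A" "(U, \<phi>) \<in> A" "open S" "S \<subseteq> U"
  shows "open (\<phi> ` S)"
proof -
  note c = chart_coverD[OF assms(1,2)]
  have "\<phi> ` S = \<phi> ` U \<inter> inv_into U \<phi> -` S"
    using assms(4) c(5) by (force simp: image_iff)
  moreover have "open (\<phi> ` U \<inter> inv_into U \<phi> -` S)"
    using c(2,3) assms(3) by (intro continuous_open_preimage) (auto simp: homeomorphism_def)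
  ultimately show ?thesis by simp
qed

lemma smooth_mapD:
  assumes "smooth_map A B S f"
  shows "continuous_on S f"
    "\<And>U \<phi> V \<psi>. \<lbrakk>(U, \<phi>) \<in> A; (V, \<psi>) \<in> B\<rbrakk> \<Longrightarrow>
      smooth_on (\<phi> ` (U \<inter> S \<inter> f -` V)) (\<psi> \<circ> f \<circ> inv_into U \<phi>)"
  using assms by (auto simp: smooth_map_def)

lemma smooth_mapI:
  assumes "continuous_on S f"
    "\<And>U \<phi> V \<psi>. \<lbrakk>(U, \<phi>) \<in> A; (V, \<psi>) \<in> B\<rbrakk> \<Longrightarrow>
      smooth_on (\<phi> ` (U \<inter> S \<inter> f -` V)) (\<psi> \<circ> f \<circ> inv_into U \<phi>)"
  shows "smooth_map A B S f"
  using assms by (auto simp: smooth_map_def)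

lemma smooth_map_subset:
  assumes "smooth_map A B S f" "T \<subseteq> S" shows "smooth_map A B T f"
proof (rule smooth_mapI)
  show "continuous_on T f"
    using smooth_mapD(1)[OF assms(1)] assms(2) continuous_on_subset by blast
  show "smooth_on (\<phi> ` (U \<inter> T \<inter> f -` V)) (\<psi> \<circ> f \<circ> inv_into U \<phi>)"
    if "(U, \<phi>) \<in> A" "(V, \<psi>) \<in> B" for U \<phi> V \<psi>
    using smooth_mapD(2)[OF assms(1) that] by (rule smooth_on_subset) (use assms(2) in auto)
qed

lemma smooth_map_compose:
  assumes A: "chart_cover A" and B: "chart_cover B" and C: "chart_cover C"
    and S: "open S" and T: "open T"
    and f: "smooth_map A B S f" and h: "smooth_map B C T h" and "f ` S \<subseteq> T"
  shows "smooth_map A C S (\<lambda>p. h (f p))"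
proof (rule smooth_mapI)
  show cont: "continuous_on S (\<lambda>p. h (f p))"
    using smooth_mapD(1)[OF f] smooth_mapD(1)[OF h] assms(8) continuous_on_compose2 by blast
  fix U \<phi> W \<kappa> assume U: "(U, \<phi>) \<in> A" and W: "(W, \<kappa>) \<in> C"
  show "smooth_on (\<phi> ` (U \<inter> S \<inter> (\<lambda>p. h (f p)) -` W)) (\<kappa> \<circ> (\<lambda>p. h (f p)) \<circ> inv_into U \<phi>)"
  proof (rule smooth_on_local)
    fix x assume "x \<in> \<phi> ` (U \<inter> S \<inter> (\<lambda>p. h (f p)) -` W)"
    then obtain p where p: "x = \<phi> p" "p \<in> U" "p \<in> S" "h (f p) \<in> W" by auto
    obtain V \<psi> where V: "(V, \<psi>) \<in> B" "f p \<in> V" by (rule chart_cover_obtain[OF B])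
    \<comment> \<open>On \<open>P\<close> the values of \<open>f\<close> stay in the single chart
      \<open>V\<close>, so the coordinate expression of the composite factors through
      \<open>\<psi>\<close>. A point of the domain may need its own \<open>V\<close>, hence the
      local criterion.\<close>
    define P where "P = U \<inter> S \<inter> f -` V \<inter> (\<lambda>p. h (f p)) -` W"
    have "P = U \<inter> (S \<inter> f -` V) \<inter> (S \<inter> (\<lambda>p. h (f p)) -` W)" by (auto simp: P_def)
    moreover have "open (S \<inter> f -` V)" "open (S \<inter> (\<lambda>p. h (f p)) -` W)"
      using chart_coverD(1)[OF B V(1)] chart_coverD(1)[OF C W] S cont smooth_mapD(1)[OF f]
      by (blast intro: continuous_open_preimage)+
    ultimately have "open P"
      using chart_coverD(1)[OF A U] by (simp add: open_Int)
    then have oP: "open (\<phi> ` P)"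
      by (rule chart_image_open[OF A U]) (auto simp: P_def)
    have "smooth_on (\<phi> ` P) (\<lambda>x. (\<kappa> \<circ> h \<circ> inv_into V \<psi>) ((\<psi> \<circ> f \<circ> inv_into U \<phi>) x))"
    proof (rule smooth_on_compose[OF oP, where f="\<psi> \<circ> f \<circ> inv_into U \<phi>"
          and g="\<kappa> \<circ> h \<circ> inv_into V \<psi>" and T="\<psi> ` (V \<inter> T \<inter> h -` W)"])
      show "smooth_on (\<phi> ` P) (\<psi> \<circ> f \<circ> inv_into U \<phi>)"
        using smooth_mapD(2)[OF f U V(1)] by (rule smooth_on_subset) (auto simp: P_def)
      show "smooth_on (\<psi> ` (V \<inter> T \<inter> h -` W)) (\<kappa> \<circ> h \<circ> inv_into V \<psi>)"
        by (rule smooth_mapD(2)[OF h V(1) W])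
      show "(\<psi> \<circ> f \<circ> inv_into U \<phi>) ` \<phi> ` P \<subseteq> \<psi> ` (V \<inter> T \<inter> h -` W)"
        using chart_coverD(5)[OF A U] assms(8) by (auto simp: P_def)
    qed
    then have "smooth_on (\<phi> ` P) (\<kappa> \<circ> (\<lambda>p. h (f p)) \<circ> inv_into U \<phi>)"
      using chart_coverD(5)[OF A U] chart_coverD(5)[OF B V(1)]
      by (elim smooth_on_cong[OF oP, THEN iffD1, rotated]) (auto simp: P_def)
    then have "smooth_on (\<phi> ` P \<inter> \<phi> ` (U \<inter> S \<inter> (\<lambda>p. h (f p)) -` W))
        (\<kappa> \<circ> (\<lambda>p. h (f p)) \<circ> inv_into U \<phi>)"
      by (rule smooth_on_subset) auto
    then show "\<exists>T. open T \<and> x \<in> T \<and>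
        smooth_on (T \<inter> \<phi> ` (U \<inter> S \<inter> (\<lambda>p. h (f p)) -` W)) (\<kappa> \<circ> (\<lambda>p. h (f p)) \<circ> inv_into U \<phi>)"
      using oP p V(2) by (intro exI[of _ "\<phi> ` P"]) (auto simp: P_def)
  qed
qed

lemma smooth_manifold_std: "smooth_manifold (std_atlas :: ('e::euclidean_space, 'e) atlas)"
  unfolding smooth_manifold_def std_atlas_def
  by (auto simp: homeomorphism_def smooth_on_bounded_linear[OF bounded_linear_ident] id_def o_def)

lemmas chart_cover_std = smooth_manifold_chart_cover[OF smooth_manifold_std]

lemma smooth_map_const: "smooth_map A B S (\<lambda>p. q)"
proof -
  have "\<psi> \<circ> (\<lambda>p. q) \<circ> h = (\<lambda>x. \<psi> q)" for \<psi> :: "'c \<Rightarrow> 'd" and h :: "'b \<Rightarrow> 'a"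
    by auto
  then show ?thesis
    by (auto simp: smooth_map_def smooth_on_const)
qed

lemma prod_atlasI:
  "\<lbrakk>(U, \<phi>) \<in> A; (V, \<psi>) \<in> B\<rbrakk> \<Longrightarrow> (U \<times> V, map_prod \<phi> \<psi>) \<in> prod_atlas A B"
  unfolding prod_atlas_def by blast

lemma prod_chart_inv:
  assumes "chart_cover A" "chart_cover B" "(U, \<phi>) \<in> A" "(V, \<psi>) \<in> B" "p \<in> U" "q \<in> V"
  shows "inv_into (U \<times> V) (map_prod \<phi> \<psi>) (\<phi> p, \<psi> q) = (p, q)"
proof -
  have "inj_on (map_prod \<phi> \<psi>) (U \<times> V)"
    using chart_coverD(4)[OF assms(1,3)] chart_coverD(4)[OF assms(2,4)] map_prod_inj_on by blast
  then show ?thesis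
    using inv_into_f_f[of "map_prod \<phi> \<psi>" "U \<times> V" "(p, q)"] assms(5,6) by simp
qed

lemma chart_cover_prod:
  assumes A: "chart_cover A" and B: "chart_cover B"
  shows "chart_cover (prod_atlas A B)"
proof -
  have "open (U \<times> V) \<and> open (map_prod \<phi> \<psi> ` (U \<times> V)) \<and>
    homeomorphism (U \<times> V) (map_prod \<phi> \<psi> ` (U \<times> V)) (map_prod \<phi> \<psi>)
      (inv_into (U \<times> V) (map_prod \<phi> \<psi>))" if U: "(U, \<phi>) \<in> A" and V: "(V, \<psi>) \<in> B" for U \<phi> V \<psi>
  proof -
    note cU = chart_coverD[OF A U] and cV = chart_coverD[OF B V]
    have im: "map_prod \<phi> \<psi> ` (U \<times> V) = \<phi> ` U \<times> \<psi> ` V" by auto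
    have c: "continuous_on (U \<times> V) (map_prod \<phi> \<psi>)"
      unfolding map_prod_def case_prod_beta
      by (rule continuous_on_Pair[OF
            continuous_on_compose2[OF homeomorphism_cont1[OF cU(3)] continuous_on_fst[OF continuous_on_id]]
            continuous_on_compose2[OF homeomorphism_cont1[OF cV(3)] continuous_on_snd[OF continuous_on_id]]])
        auto
    have "continuous_on (\<phi> ` U \<times> \<psi> ` V) (\<lambda>z. (inv_into U \<phi> (fst z), inv_into V \<psi> (snd z)))"
      by (rule continuous_on_Pair[OF
            continuous_on_compose2[OF homeomorphism_cont2[OF cU(3)] continuous_on_fst[OF continuous_on_id]]
            continuous_on_compose2[OF homeomorphism_cont2[OF cV(3)] continuous_on_snd[OF continuous_on_id]]])
        auto
    then have i: "continuous_on (\<phi> ` U \<times> \<psi> ` V) (inv_into (U \<times> V) (map_prod \<phi> \<psi>))"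
      by (rule continuous_on_eq) (auto simp: cU(5) cV(5) prod_chart_inv[OF A B U V])
    have "homeomorphism (U \<times> V) (map_prod \<phi> \<psi> ` (U \<times> V)) (map_prod \<phi> \<psi>)
      (inv_into (U \<times> V) (map_prod \<phi> \<psi>))"
      by (rule homeomorphismI) (use c i in \<open>auto simp: im prod_chart_inv[OF A B U V]\<close>)
    then show ?thesis
      using cU(1,2) cV(1,2) by (auto simp: im open_Times)
  qed
  moreover have "(\<Union>(U, \<phi>)\<in>prod_atlas A B. U) = UNIV"
  proof -
    have "\<exists>S f. (S, f) \<in> prod_atlas A B \<and> (p, q) \<in> S" for p q
    proof -
      obtain U \<phi> where U: "(U, \<phi>) \<in> A" "p \<in> U" by (rule chart_cover_obtain[OF A])
      obtain V \<psi> where V: "(V, \<psi>) \<in> B" "q \<in> V" by (rule chart_cover_obtain[OF B])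
      show ?thesis using prod_atlasI[OF U(1) V(1)] U(2) V(2) by blast
    qed
    then show ?thesis by fastforce
  qed
  ultimately show ?thesis
    unfolding chart_cover_def by (auto simp: prod_atlas_def)
qed

lemma smooth_map_Pair:
  assumes A: "chart_cover A" and B: "chart_cover B" and C: "chart_cover C" and S: "open S"
    and f: "smooth_map A B S f" and h: "smooth_map A C S h"
  shows "smooth_map A (prod_atlas B C) S (\<lambda>p. (f p, h p))"
proof (rule smooth_mapI)
  show "continuous_on S (\<lambda>p. (f p, h p))"
    using smooth_mapD(1)[OF f] smooth_mapD(1)[OF h] by (intro continuous_intros)
  fix U \<phi> Q \<theta> assume U: "(U, \<phi>) \<in> A" and "(Q, \<theta>) \<in> prod_atlas B C"
  then obtain V \<psi> W \<kappa> where Q: "Q = V \<times> W" "\<theta> = map_prod \<psi> \<kappa>"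
    and V: "(V, \<psi>) \<in> B" and W: "(W, \<kappa>) \<in> C" by (auto simp: prod_atlas_def)
  define P where "P = U \<inter> S \<inter> (\<lambda>p. (f p, h p)) -` Q"
  have "P = U \<inter> (S \<inter> f -` V) \<inter> (S \<inter> h -` W)" by (auto simp: P_def Q)
  moreover have "open (S \<inter> f -` V)" "open (S \<inter> h -` W)"
    using chart_coverD(1)[OF B V] chart_coverD(1)[OF C W] S smooth_mapD(1)[OF f] smooth_mapD(1)[OF h]
    by (blast intro: continuous_open_preimage)+
  ultimately have "open P"
    using chart_coverD(1)[OF A U] by (simp add: open_Int)
  then have oP: "open (\<phi> ` P)"
    by (rule chart_image_open[OF A U]) (auto simp: P_def)
  have "smooth_on (\<phi> ` P) (\<lambda>x. ((\<psi> \<circ> f \<circ> inv_into U \<phi>) x, (\<kappa> \<circ> h \<circ> inv_into U \<phi>) x))"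
    by (rule smooth_on_Pair[OF oP smooth_on_subset[OF smooth_mapD(2)[OF f U V]]
          smooth_on_subset[OF smooth_mapD(2)[OF h U W]]])
      (auto simp: P_def Q)
  moreover have "\<theta> \<circ> (\<lambda>p. (f p, h p)) \<circ> inv_into U \<phi>
     = (\<lambda>x. ((\<psi> \<circ> f \<circ> inv_into U \<phi>) x, (\<kappa> \<circ> h \<circ> inv_into U \<phi>) x))"
    by (auto simp: Q)
  ultimately show "smooth_on (\<phi> ` (U \<inter> S \<inter> (\<lambda>p. (f p, h p)) -` Q))
      (\<theta> \<circ> (\<lambda>p. (f p, h p)) \<circ> inv_into U \<phi>)"
    by (simp add: P_def)
qed

lemma smooth_manifoldD:
  "\<lbrakk>smooth_manifold A; (U, \<phi>) \<in> A; (V, \<psi>) \<in> A\<rbrakk> \<Longrightarrow> smooth_on (\<phi> ` (U \<inter> V)) (\<psi> \<circ> inv_into U \<phi>)"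
  by (auto simp: smooth_manifold_def)

lemma smooth_map_ident:
  assumes "smooth_manifold A" shows "smooth_map A A S (\<lambda>p. p)"
proof (rule smooth_mapI)
  show "smooth_on (\<phi> ` (U \<inter> S \<inter> (\<lambda>p. p) -` V)) (\<psi> \<circ> (\<lambda>p. p) \<circ> inv_into U \<phi>)"
    if "(U, \<phi>) \<in> A" "(V, \<psi>) \<in> A" for U \<phi> V \<psi>
    using smooth_on_subset[OF smooth_manifoldD[OF assms that], of "\<phi> ` (U \<inter> S \<inter> (\<lambda>p. p) -` V)"]
    by (auto simp: o_def)
qed (simp add: continuous_on_id)

lemma smooth_map_fst:
  assumes A: "smooth_manifold A" and B: "chart_cover B"
  shows "smooth_map (prod_atlas A B) A UNIV fst"
proof (rule smooth_mapI)
  show "continuous_on UNIV fst" by (intro continuous_intros)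
  note cA = smooth_manifold_chart_cover[OF A]
  fix Q \<theta> U' \<phi>' assume Q0: "(Q, \<theta>) \<in> prod_atlas A B" and U': "(U', \<phi>') \<in> A"
  then obtain V \<psi> U \<phi> where Q: "Q = U \<times> V" "\<theta> = map_prod \<phi> \<psi>"
    and U: "(U, \<phi>) \<in> A" and V: "(V, \<psi>) \<in> B" by (auto simp: prod_atlas_def)
  define P where "P = Q \<inter> fst -` U'"
  have oP: "open (\<theta> ` P)"
    by (rule chart_image_open[OF chart_cover_prod[OF cA B] Q0])
      (auto simp: P_def Q intro!: open_Int open_Times chart_coverD(1)[OF cA] chart_coverD(1)[OF B]
        U V U' open_vimage_fst)
  have "smooth_on (\<theta> ` P) (\<lambda>z. (\<phi>' \<circ> inv_into U \<phi>) (fst z))"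
    by (rule smooth_on_compose[OF oP smooth_on_bounded_linear[OF bounded_linear_fst]
          smooth_manifoldD[OF A U U']]) (auto simp: P_def Q)
  then have "smooth_on (\<theta> ` P) (\<phi>' \<circ> fst \<circ> inv_into Q \<theta>)"
    by (elim smooth_on_cong[OF oP, THEN iffD1, rotated])
      (auto simp: P_def Q prod_chart_inv[OF cA B U V] chart_coverD(5)[OF cA U])
  then show "smooth_on (\<theta> ` (Q \<inter> UNIV \<inter> fst -` U')) (\<phi>' \<circ> fst \<circ> inv_into Q \<theta>)"
    by (simp add: P_def)
qed

lemma smooth_map_snd:
  assumes A: "chart_cover A" and B: "smooth_manifold B"
  shows "smooth_map (prod_atlas A B) B UNIV snd"
proof (rule smooth_mapI)
  show "continuous_on UNIV snd" by (intro continuous_intros)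
  note cB = smooth_manifold_chart_cover[OF B]
  fix Q \<theta> V' \<psi>' assume Q0: "(Q, \<theta>) \<in> prod_atlas A B" and V': "(V', \<psi>') \<in> B"
  then obtain V \<psi> U \<phi> where Q: "Q = U \<times> V" "\<theta> = map_prod \<phi> \<psi>"
    and U: "(U, \<phi>) \<in> A" and V: "(V, \<psi>) \<in> B" by (auto simp: prod_atlas_def)
  define P where "P = Q \<inter> snd -` V'"
  have oP: "open (\<theta> ` P)"
    by (rule chart_image_open[OF chart_cover_prod[OF A cB] Q0])
      (auto simp: P_def Q intro!: open_Int open_Times chart_coverD(1)[OF cB] chart_coverD(1)[OF A]
        U V V' open_vimage_snd)
  have "smooth_on (\<theta> ` P) (\<lambda>z. (\<psi>' \<circ> inv_into V \<psi>) (snd z))"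
    by (rule smooth_on_compose[OF oP smooth_on_bounded_linear[OF bounded_linear_snd]
          smooth_manifoldD[OF B V V']]) (auto simp: P_def Q)
  then have "smooth_on (\<theta> ` P) (\<psi>' \<circ> snd \<circ> inv_into Q \<theta>)"
    by (elim smooth_on_cong[OF oP, THEN iffD1, rotated])
      (auto simp: P_def Q prod_chart_inv[OF A cB U V] chart_coverD(5)[OF cB V])
  then show "smooth_on (\<theta> ` (Q \<inter> UNIV \<inter> snd -` V')) (\<psi>' \<circ> snd \<circ> inv_into Q \<theta>)"
    by (simp add: P_def)
qed

text \<open>Continuity, which \<open>smooth_map\<close> demands separately, is automatic for real
  functions: on a chart domain \<open>f\<close> is its smooth coordinate expression composed with
  the homeomorphism \<open>\<phi>\<close>.\<close>

lemma smooth_functions_iff: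
  fixes A :: "('m::t2_space, 'e::euclidean_space) atlas"
  assumes A: "chart_cover A"
  shows "f \<in> smooth_functions A \<longleftrightarrow> (\<forall>(U, \<phi>)\<in>A. smooth_on (\<phi> ` U) (\<lambda>x. f (inv_into U \<phi> x)))"
proof
  assume "f \<in> smooth_functions A"
  then show "\<forall>(U, \<phi>)\<in>A. smooth_on (\<phi> ` U) (\<lambda>x. f (inv_into U \<phi> x))"
    using smooth_mapD(2)[of A std_atlas UNIV f _ _ UNIV id]
    by (auto simp: smooth_functions_def std_atlas_def o_def)
next
  assume R: "\<forall>(U, \<phi>)\<in>A. smooth_on (\<phi> ` U) (\<lambda>x. f (inv_into U \<phi> x))"
  have "continuous (at p) f" for p
  proof -
    obtain U \<phi> where U: "(U, \<phi>) \<in> A" "p \<in> U" by (rule chart_cover_obtain[OF A])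
    have "continuous_on (\<phi> ` U) (\<lambda>x. f (inv_into U \<phi> x))"
      using R U by (intro smooth_on_imp_continuous_on) auto
    moreover have "continuous_on U \<phi>"
      using chart_coverD(3)[OF A U(1)] by (simp add: homeomorphism_def)
    ultimately have "continuous_on U (\<lambda>p. f (inv_into U \<phi> (\<phi> p)))"
      by (rule continuous_on_compose2) auto
    then have "continuous_on U f"
      by (rule continuous_on_eq) (simp add: chart_coverD(5)[OF A U(1)])
    then show ?thesis
      using U chart_coverD(1)[OF A U(1)] by (simp add: continuous_on_eq_continuous_at)
  qed
  then have "continuous_on UNIV f" by (simp add: continuous_on_eq_continuous_at)
  then show "f \<in> smooth_functions A"
    using R by (auto simp: smooth_functions_def smooth_map_def std_atlas_def o_def)
qed

lemma smooth_functions_intros: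
  fixes A :: "('m::t2_space, 'e::euclidean_space) atlas"
  assumes A: "chart_cover A"
  shows "(\<lambda>p. r) \<in> smooth_functions A"
    and "\<lbrakk>f \<in> smooth_functions A; h \<in> smooth_functions A\<rbrakk> \<Longrightarrow> (\<lambda>p. f p + h p) \<in> smooth_functions A"
    and "\<lbrakk>f \<in> smooth_functions A; h \<in> smooth_functions A\<rbrakk> \<Longrightarrow> (\<lambda>p. f p * h p) \<in> smooth_functions A"
  using chart_coverD(2)[OF A]
  by (auto simp: smooth_functions_iff[OF A] smooth_on_const intro!: smooth_on_add smooth_on_mult)


section \<open>Tangent vectors\<close>

lemma velocity_apply:
  "f \<in> smooth_functions A \<Longrightarrow> velocity A c f = deriv (\<lambda>t. f (c t)) 0"
  by (simp add: velocity_def o_def)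

context
  fixes A :: "('m::t2_space, 'e::euclidean_space) atlas" and v :: "'m tangent" and p
  assumes A: "chart_cover A" and v: "v \<in> tangent_space A p"
begin

lemma tangent_const: "v (\<lambda>p. r) = 0"
  using v smooth_functions_intros(1)[OF A] by (auto simp: tangent_space_def velocity_apply)

end

section \<open>Left invariant vector fields\<close>

locale lie_grp =
  fixes A :: "('g::{t2_space,second_countable_topology}, 'e::euclidean_space) atlas"
    and mul :: "'g \<Rightarrow> 'g \<Rightarrow> 'g" and e :: 'g and iv :: "'g \<Rightarrow> 'g"
  assumes lie_group: "lie_group A mul e iv"
begin

lemma manifold: "smooth_manifold A"
  and smooth_mul: "smooth_map (prod_atlas A A) A UNIV (\<lambda>(a, b). mul a b)"
  using lie_group by (auto simp: lie_group_def)

lemmas cover = smooth_manifold_chart_cover[OF manifold]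

lemma mul_simps [simp]:
  "mul (mul a b) c = mul a (mul b c)" "mul e a = a" "mul a e = a"
  "mul (iv a) a = e" "mul a (iv a) = e" "mul (iv a) (mul a b) = b" "mul a (mul (iv a) b) = b"
proof -
  interpret group mul e iv using lie_group by (simp add: lie_group_def)
  show "mul (mul a b) c = mul a (mul b c)" "mul e a = a" "mul a e = a"
    "mul (iv a) a = e" "mul a (iv a) = e"
    by (simp_all add: assoc)
  show "mul (iv a) (mul a b) = b" "mul a (mul (iv a) b) = b"
    by (simp_all flip: assoc)
qed

lemma smooth_map_mul:
  assumes "chart_cover B" "open S" "smooth_map B A S f" "smooth_map B A S h"
  shows "smooth_map B A S (\<lambda>x. mul (f x) (h x))"
  using smooth_map_compose[OF assms(1) chart_cover_prod[OF cover cover] cover assms(2) open_UNIV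
      smooth_map_Pair[OF assms(1) cover cover assms(2-4)] smooth_mul]
  by simp

text \<open>Both implications matter. Velocities are 0 on non-smooth functions, so a translated
  velocity is again a velocity only if translation preserves non-smoothness as well as
  smoothness.\<close>

lemma smooth_functions_left_translation:
  "(\<lambda>q. f (mul a q)) \<in> smooth_functions A \<longleftrightarrow> f \<in> smooth_functions A"
proof -
  have L: "(\<lambda>q. f (mul a q)) \<in> smooth_functions A" if "f \<in> smooth_functions A" for f a
    unfolding smooth_functions_def mem_Collect_eq
    by (rule smooth_map_compose[OF cover cover chart_cover_std open_UNIV open_UNIV
          smooth_map_mul[OF cover open_UNIV smooth_map_const smooth_map_ident[OF manifold]]])
      (use that in \<open>auto simp: smooth_functions_def\<close>)
  show ?thesis
    using L[of f a] L[of "\<lambda>q. f (mul a q)" "iv a"] by auto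
qed

lemma push_left_velocity: "push_left mul a (velocity A c) = velocity A (\<lambda>t. mul a (c t))"
  by (auto simp: push_left_def velocity_def smooth_functions_left_translation o_def)

lemma push_left_tangent:
  assumes "v \<in> tangent_space A p" shows "push_left mul a v \<in> tangent_space A (mul a p)"
proof -
  obtain c \<epsilon> where c: "v = velocity A c" "0 < \<epsilon>" "smooth_map std_atlas A {-\<epsilon><..<\<epsilon>} c" "c 0 = p"
    using assms by (auto simp: tangent_space_def)
  have "smooth_map std_atlas A {-\<epsilon><..<\<epsilon>} (\<lambda>t. mul a (c t))"
    by (rule smooth_map_mul[OF chart_cover_std _ smooth_map_const c(3)]) auto
  then show ?thesis
    using c by (auto simp: tangent_space_def push_left_velocity)
qed

lemma push_left_push_left: "push_left mul a (push_left mul b v) = push_left mul (mul a b) v"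
  by (simp add: push_left_def)

lemma push_left_e: "push_left mul e v = v"
  by (simp add: push_left_def)

text \<open>The function is the derivative of \<open>f\<close> along the left invariant extension of
  the velocity of \<open>c\<close>. It is smooth because it is a partial derivative in
  \<open>t\<close> of a smooth function of the pair \<open>(p, t)\<close>, restricted to
  \<open>t = 0\<close>.\<close>

lemma smooth_velocity_translates:
  assumes f: "f \<in> smooth_functions A" and "0 < \<epsilon>" and c: "smooth_map std_atlas A {-\<epsilon><..<\<epsilon>} c"
  shows "(\<lambda>p. deriv (\<lambda>t. f (mul p (c t))) 0) \<in> smooth_functions A"
proof -
  let ?I = "{-\<epsilon><..<\<epsilon>}"
  let ?P = "prod_atlas A (std_atlas :: (real, real) atlas)"
  note P = chart_cover_prod[OF cover chart_cover_std]
  have o: "open (UNIV \<times> ?I)" by (intro open_Times) auto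
  have "smooth_map ?P A (UNIV \<times> ?I) (\<lambda>z. mul (fst z) (c (snd z)))"
  proof (rule smooth_map_mul[OF P o])
    show "smooth_map ?P A (UNIV \<times> ?I) fst"
      by (rule smooth_map_subset[OF smooth_map_fst[OF manifold chart_cover_std] subset_UNIV])
    show "smooth_map ?P A (UNIV \<times> ?I) (\<lambda>z. c (snd z))"
      by (rule smooth_map_compose[OF P chart_cover_std cover o open_greaterThanLessThan
            smooth_map_subset[OF smooth_map_snd[OF cover smooth_manifold_std] subset_UNIV] c]) auto
  qed
  then have F: "smooth_map ?P std_atlas (UNIV \<times> ?I) (\<lambda>z. f (mul (fst z) (c (snd z))))"
    by (rule smooth_map_compose[OF P cover chart_cover_std o open_UNIV])
      (use f in \<open>auto simp: smooth_functions_def\<close>)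
  have "smooth_on (\<phi> ` U) (\<lambda>x. deriv (\<lambda>t. f (mul (inv_into U \<phi> x) (c t))) 0)"
    if U: "(U, \<phi>) \<in> A" for U \<phi>
  proof -
    note cU = chart_coverD[OF cover U]
    let ?G = "\<lambda>z. f (mul (inv_into U \<phi> (fst z)) (c (snd z)))"
    have V: "(UNIV, id) \<in> (std_atlas :: (real, real) atlas)" by (simp add: std_atlas_def)
    have im: "map_prod \<phi> id ` (U \<times> UNIV \<inter> (UNIV \<times> ?I)) = \<phi> ` U \<times> ?I"
      by (simp add: map_prod_def image_paired_Times Times_Int_Times)
    have oG: "open (\<phi> ` U \<times> ?I)" by (intro open_Times cU) auto
    have "smooth_on (\<phi> ` U \<times> ?I)
        (id \<circ> (\<lambda>z. f (mul (fst z) (c (snd z)))) \<circ> inv_into (U \<times> UNIV) (map_prod \<phi> id))"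
    proof -
      have "(U \<times> UNIV, map_prod \<phi> id) \<in> ?P"
        by (rule prod_atlasI[OF U V])
      moreover have "(UNIV, id) \<in> std_atlas" by (simp add: std_atlas_def)
      ultimately show ?thesis
        using smooth_mapD(2)[OF F, of "U \<times> UNIV" "map_prod \<phi> id" UNIV id] by (simp add: im)
    qed
    then have G: "smooth_on (\<phi> ` U \<times> ?I) ?G"
    proof (elim smooth_on_cong[OF oG, THEN iffD1, rotated])
      fix z assume "z \<in> \<phi> ` U \<times> ?I"
      then obtain p t where z: "z = (\<phi> p, id t)" "p \<in> U" by auto
      show "(id \<circ> (\<lambda>z. f (mul (fst z) (c (snd z)))) \<circ> inv_into (U \<times> UNIV) (map_prod \<phi> id)) z = ?G z"
        unfolding z(1) using prod_chart_inv[OF cover chart_cover_std U V z(2), of t] cU(5)[OF z(2)]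
        by simp
    qed
    \<comment> \<open>A derivative along the slice \<open>t \<mapsto> (x, t)\<close> is the
      directional derivative of \<open>?G\<close> in the fixed direction \<open>(0, 1)\<close>, and
      such derivatives of smooth maps are smooth.\<close>
    have D: "deriv (\<lambda>t. f (mul (inv_into U \<phi> x) (c t))) 0 = frechet_derivative ?G (at (x, 0)) (0, 1)"
      if x: "x \<in> \<phi> ` U" for x
    proof -
      have d: "(?G has_derivative frechet_derivative ?G (at (x, 0))) (at (x, 0))"
        using smooth_on_imp_differentiable[OF G, of "(x, 0)"] x \<open>0 < \<epsilon>\<close>
        by (simp add: frechet_derivative_works)
      have "((\<lambda>t. (x, t)) has_derivative (\<lambda>h. (0, h))) (at (0::real))"
        by (intro derivative_eq_intros) auto
      from diff_chain_at[OF this d]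
      have *: "((\<lambda>t. f (mul (inv_into U \<phi> x) (c t))) has_derivative
          (\<lambda>h. frechet_derivative ?G (at (x, 0)) (0, h))) (at 0)"
        by (simp add: o_def)
      have "(\<lambda>h. frechet_derivative ?G (at (x, 0)) (0, h)) = (*) (frechet_derivative ?G (at (x, 0)) (0, 1))"
      proof
        show "frechet_derivative ?G (at (x, 0)) (0, h) = frechet_derivative ?G (at (x, 0)) (0, 1) * h" for h
          using linear_scale[OF has_derivative_linear[OF *], of h 1] by simp
      qed
      from has_derivative_eq_rhs[OF * this] show ?thesis
        by (intro DERIV_imp_deriv) (simp only: has_field_derivative_def)
    qed
    have "smooth_on (\<phi> ` U) (\<lambda>x. frechet_derivative ?G (at (x, 0)) (0, 1))"
      by (rule smooth_on_compose[OF cU(2) smooth_on_Pair[OF cU(2)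
              smooth_on_bounded_linear[OF bounded_linear_ident] smooth_on_const]
            smooth_on_frechet_derivative[OF G]])
        (use \<open>0 < \<epsilon>\<close> in auto)
    then show ?thesis
      by (elim smooth_on_cong[OF cU(2), THEN iffD1, rotated]) (simp add: D)
  qed
  then show ?thesis
    by (auto simp: smooth_functions_iff[OF cover])
qed

lemma vector_fieldD:
  assumes "X \<in> vector_fields A"
  shows "X p \<in> tangent_space A p" "f \<in> smooth_functions A \<Longrightarrow> app X f \<in> smooth_functions A"
  using assms by (auto simp: vector_fields_def)

lemma left_invariant_extension:
  assumes u: "u \<in> tangent_space A e"
  shows "(\<lambda>p. push_left mul p u) \<in> lie_algebra A mul"
proof -
  obtain c \<epsilon> where c: "u = velocity A c" "0 < \<epsilon>" "smooth_map std_atlas A {-\<epsilon><..<\<epsilon>} c" "c 0 = e"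
    using u by (auto simp: tangent_space_def)
  have "app (\<lambda>p. push_left mul p u) f \<in> smooth_functions A" if f: "f \<in> smooth_functions A" for f
    using smooth_velocity_translates[OF f c(2,3)]
    by (simp add: app_def c(1) push_left_velocity velocity_apply[OF f])
  then show ?thesis
    using push_left_tangent[OF u] by (auto simp: lie_algebra_def vector_fields_def push_left_push_left)
qed

text \<open>A vector at \<open>p\<close> is translated to \<open>e\<close> by \<open>iv p\<close>
  and extended from there. Linear structure on the left invariant fields thereby passes to every
  tangent space.\<close>

lemma tangent_space_lie_algebra:
  "tangent_space A p = (\<lambda>X. X p) ` lie_algebra A mul"
proof -
  have "\<exists>X\<in>lie_algebra A mul. v = X p" if v: "v \<in> tangent_space A p" for v
    using left_invariant_extension[of "push_left mul (iv p) v"] push_left_tangent[OF v, of "iv p"]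
    by (intro bexI[of _ "\<lambda>q. push_left mul q (push_left mul (iv p) v)"])
      (simp_all add: push_left_push_left push_left_e)
  then show ?thesis
    by (auto simp: lie_algebra_def vector_fields_def)
qed

lemma lie_algebra_translate: "X \<in> lie_algebra A mul \<Longrightarrow> X p = push_left mul p (X e)"
  unfolding lie_algebra_def by (metis (mono_tags, lifting) mem_Collect_eq mul_simps(3))

end


section \<open>Orthonormal left invariant frames\<close>

text \<open>\<open>E\<close> identifies a Euclidean space with the Euclidean Lie algebra, \<open>br\<close> is the bracket in these
  coordinates, and \<open>N\<close> is the Levi-Civita product, given by Koszul's formula.\<close>

locale lie_frame = lie_grp A mul e iv
  for A :: "('g::{t2_space,second_countable_topology}, 'e::euclidean_space) atlas"
    and mul :: "'g \<Rightarrow> 'g \<Rightarrow> 'g" and e :: 'g and iv :: "'g \<Rightarrow> 'g" +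
  fixes g :: "'g metric_tensor" and D :: "'g connection"
    and E :: "'v::euclidean_space \<Rightarrow> 'g vfield" and br N :: "'v \<Rightarrow> 'v \<Rightarrow> 'v"
  assumes metric: "riemannian_metric A g" and left_invariant: "left_invariant_metric A mul g"
    and levi_civita: "levi_civita A g D"
    and E_range: "lie_algebra A mul = range E"
    and E_add: "E (x + y) = E x + E y"
    and E_scale: "E (r *\<^sub>R x) = cmult r (E x)"
    and E_inner: "lie_inner g e (E x) (E y) = x \<bullet> y"
    and E_bracket: "bracket (E x) (E y) = E (br x y)"
    and N: "2 * (N x y \<bullet> z) = br x y \<bullet> z - br y z \<bullet> x + br z x \<bullet> y"
begin

abbreviation "VF \<equiv> vector_fields A"
abbreviation "SF \<equiv> smooth_functions A"

lemma E_in: "E x \<in> lie_algebra A mul" "E x \<in> VF"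
  using E_range by (auto simp: lie_algebra_def)

lemma E_tangent: "E x p \<in> tangent_space A p"
  using E_in(2) by (rule vector_fieldD)

lemma tangentE:
  assumes "u \<in> tangent_space A p" obtains x where "u = E x p"
  using assms E_range by (auto simp: tangent_space_lie_algebra)

lemma E_add_at: "E x p + E y p = E (x + y) p"
  by (simp add: E_add)

lemma E_scale_at: "(\<lambda>f. r * E x p f) = E (r *\<^sub>R x) p"
  by (simp add: E_scale cmult_def)

lemma E_diff: "E (x - y) = E x - E y"
  using E_add[of "x - y" y] by (simp add: algebra_simps)

lemma E_0: "E 0 = 0"
  using E_diff[of 0 0] by simp

lemma E_inner_at: "g p (E x p) (E y p) = x \<bullet> y"
proof -
  have "g (mul p e) (push_left mul p (E x e)) (push_left mul p (E y e)) = g e (E x e) (E y e)"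
    using left_invariant E_tangent unfolding left_invariant_metric_def by blast
  then show ?thesis
    using lie_algebra_translate[OF E_in(1), of x p] lie_algebra_translate[OF E_in(1), of y p]
      E_inner[of x y] by (simp add: lie_inner_def)
qed

lemma g_commute:
  "\<lbrakk>u \<in> tangent_space A p; v \<in> tangent_space A p\<rbrakk> \<Longrightarrow> g p u v = g p v u"
  by (elim tangentE) (simp add: E_inner_at inner_commute)

lemma E_sum: "E (\<Sum>i\<in>I. x i) = (\<Sum>i\<in>I. E (x i))"
  by (induction I rule: infinite_finite_induct) (simp_all add: E_0 E_add)

lemma fmult_apply: "fmult h X p = (\<lambda>f. h p * X p f)"
  by (simp add: fmult_def)

text \<open>That a sum of two velocities is a velocity is not visible from curves. Here both are
  values of frame fields \<open>E x\<close> and \<open>E y\<close>, so their sum is the value of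
  \<open>E (x + y)\<close>.\<close>

lemma vector_fields_add: 
  assumes "X \<in> VF" "Y \<in> VF" shows "X + Y \<in> VF"
proof -
  have "X p + Y p \<in> tangent_space A p" for p
    using vector_fieldD(1)[OF assms(1), of p] vector_fieldD(1)[OF assms(2), of p]
    by (elim tangentE) (simp add: E_add_at E_tangent)
  moreover have "app (X + Y) f \<in> SF" if "f \<in> SF" for f
    using smooth_functions_intros(2)[OF cover vector_fieldD(2)[OF assms(1) that]
        vector_fieldD(2)[OF assms(2) that]]
    by (simp add: app_def)
  ultimately show ?thesis by (simp add: vector_fields_def)
qed

lemma vector_fields_fmult:
  assumes "h \<in> SF" "X \<in> VF" shows "fmult h X \<in> VF"
proof -
  have "fmult h X p \<in> tangent_space A p" for p
    using vector_fieldD(1)[OF assms(2), of p]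
    by (elim tangentE) (simp add: fmult_apply E_scale_at E_tangent)
  moreover have "app (fmult h X) f \<in> SF" if "f \<in> SF" for f
    using smooth_functions_intros(3)[OF cover assms(1) vector_fieldD(2)[OF assms(2) that]]
    by (simp add: app_def fmult_def)
  ultimately show ?thesis by (simp add: vector_fields_def)
qed

lemma const_in_SF: "(\<lambda>p. r) \<in> SF"
  by (rule smooth_functions_intros(1)[OF cover])

lemma vector_fields_zero: "0 \<in> VF"
  using E_in(2)[of 0] by (simp add: E_0)

lemma affine: "affine_connection A D"
  and torsion: "\<lbrakk>X \<in> VF; Y \<in> VF\<rbrakk> \<Longrightarrow> bracket X Y = D X Y - D Y X"
  and compatible: "\<lbrakk>X \<in> VF; Y \<in> VF; Z \<in> VF\<rbrakk> \<Longrightarrow>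
    app X (pair_fields g Y Z) = pair_fields g (D X Y) Z + pair_fields g Y (D X Z)"
  using levi_civita by (auto simp: levi_civita_def)

lemma D_in: "\<lbrakk>X \<in> VF; Y \<in> VF\<rbrakk> \<Longrightarrow> D X Y \<in> VF"
  and D_add_left: "\<lbrakk>X \<in> VF; X' \<in> VF; Y \<in> VF\<rbrakk> \<Longrightarrow> D (X + X') Y = D X Y + D X' Y"
  and D_fmult_left: "\<lbrakk>h \<in> SF; X \<in> VF; Y \<in> VF\<rbrakk> \<Longrightarrow> D (fmult h X) Y = fmult h (D X Y)"
  and D_add_right: "\<lbrakk>X \<in> VF; Y \<in> VF; Y' \<in> VF\<rbrakk> \<Longrightarrow> D X (Y + Y') = D X Y + D X Y'"
  and D_fmult_right: "\<lbrakk>h \<in> SF; X \<in> VF; Y \<in> VF\<rbrakk> \<Longrightarrow>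
    D X (fmult h Y) = fmult h (D X Y) + fmult (app X h) Y"
  using affine by (auto simp: affine_connection_def)

text \<open>Expresses differences by the two operations under which \<open>VF\<close> is closed and
  for which \<open>D\<close> has rules.\<close>

lemma diff_eq_fmult: "X - Y = X + fmult (\<lambda>p. - 1) Y"
  by (simp add: fun_eq_iff fmult_def)

lemma bracket_in: "\<lbrakk>X \<in> VF; Y \<in> VF\<rbrakk> \<Longrightarrow> bracket X Y \<in> VF"
  by (simp add: torsion D_in vector_fields_add vector_fields_fmult const_in_SF diff_eq_fmult)

lemma curvature_in: "\<lbrakk>X \<in> VF; Y \<in> VF; Z \<in> VF\<rbrakk> \<Longrightarrow> curvature D X Y Z \<in> VF"
  by (simp add: curvature_def D_in bracket_in vector_fields_add vector_fields_fmult const_in_SF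
      diff_eq_fmult)

lemma app_in: "\<lbrakk>h \<in> SF; X \<in> VF\<rbrakk> \<Longrightarrow> app X h \<in> SF"
  by (rule vector_fieldD(2))

lemmas closed = D_in bracket_in curvature_in app_in vector_fields_add vector_fields_fmult const_in_SF

subsection \<open>The connection on the frame\<close>

text \<open>Koszul's argument. Pairings of frame fields are constant, so compatibility makes
  \<open>c x y z\<close> skew in \<open>y\<close> and \<open>z\<close>; vanishing torsion gives the
  difference of \<open>c x y z\<close> and \<open>c y x z\<close>. Over the permutations of
  \<open>x\<close>, \<open>y\<close>, \<open>z\<close> these linear relations determine
  \<open>c\<close>, and the product \<open>N\<close> has the resulting inner products.\<close>

lemma D_E: "D (E x) (E y) = E (N x y)"
proof
  fix p
  define c where "c x y z = g p (D (E x) (E y) p) (E z p)" for x y z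
  have D_tangent: "D (E x) (E y) p \<in> tangent_space A p" for x y
    by (rule vector_fieldD(1)[OF D_in[OF E_in(2) E_in(2)]])
  have "c x y z + c x z y = 0" for x y z
  proof -
    have "app (E x) (pair_fields g (E y) (E z)) p = 0"
      using tangent_const[OF cover E_tangent] by (simp add: app_def pair_fields_def E_inner_at)
    then show ?thesis
      using compatible[OF E_in(2) E_in(2) E_in(2), of x y z] g_commute[OF E_tangent D_tangent]
      by (simp add: c_def pair_fields_def fun_eq_iff)
  qed
  moreover have "c x y z = c y x z + br x y \<bullet> z" for x y z
  proof -
    obtain w where w: "D (E y) (E x) p = E w p"
      using D_tangent by (rule tangentE)
    have "D (E x) (E y) = D (E y) (E x) + E (br x y)"
      using torsion[OF E_in(2) E_in(2), of x y] by (simp add: E_bracket algebra_simps)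
    then have "D (E x) (E y) p = E (w + br x y) p"
      by (simp add: w E_add)
    then show ?thesis
      by (simp add: c_def w E_inner_at inner_add_left)
  qed
  ultimately have koszul: "c x y z = N x y \<bullet> z" for z
    using N[of x y z] by (smt (verit))
  obtain w where w: "D (E x) (E y) p = E w p"
    using D_tangent by (rule tangentE)
  then have "w \<bullet> z = N x y \<bullet> z" for z
    using koszul[of z] by (simp add: c_def E_inner_at)
  then have "w = N x y"
    using euclidean_eq_iff by blast
  then show "D (E x) (E y) p = E (N x y) p"
    by (simp add: w)
qed

definition Rm :: "'v \<Rightarrow> 'v \<Rightarrow> 'v \<Rightarrow> 'v" where
  "Rm x y z = N (br x y) z - N x (N y z) + N y (N x z)"

lemma curvature_E: "curvature D (E x) (E y) (E z) = E (Rm x y z)"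
  by (simp add: curvature_def E_bracket D_E Rm_def E_add E_diff)

subsection \<open>Tensoriality\<close>

text \<open>This and the next rule follow from \<open>torsion\<close> and the axioms of
  \<open>D\<close>. From the definition of \<open>bracket\<close> they would require additivity and
  the product rule for tangent vectors.\<close>

lemma bracket_add: "\<lbrakk>X \<in> VF; X' \<in> VF; Y \<in> VF\<rbrakk> \<Longrightarrow> bracket (X + X') Y = bracket X Y + bracket X' Y"
  by (simp add: torsion closed D_add_left D_add_right)

lemma bracket_fmult:
  "\<lbrakk>h \<in> SF; X \<in> VF; Y \<in> VF\<rbrakk> \<Longrightarrow>
    bracket (fmult h X) Y = fmult h (bracket X Y) + fmult (\<lambda>p. -1) (fmult (app Y h) X)"
  by (simp add: torsion closed D_fmult_left D_fmult_right) (simp add: fun_eq_iff fmult_def algebra_simps)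

text \<open>Reduces function-linearity in the second argument to that in the first.\<close>

lemma curvature_swap:
  assumes "X \<in> VF" "Y \<in> VF" "Z \<in> VF"
  shows "curvature D X Y Z = fmult (\<lambda>p. -1) (curvature D Y X Z)"
proof -
  have "bracket X Y = fmult (\<lambda>p. -1) (bracket Y X)"
    by (simp add: bracket_def fmult_def fun_eq_iff)
  then show ?thesis
    using assms by (simp add: curvature_def D_fmult_left closed) (simp add: fun_eq_iff fmult_def)
qed

lemma curvature_add1:
  "\<lbrakk>X \<in> VF; X' \<in> VF; Y \<in> VF; Z \<in> VF\<rbrakk> \<Longrightarrow>
    curvature D (X + X') Y Z = curvature D X Y Z + curvature D X' Y Z"
  by (simp add: curvature_def bracket_add closed D_add_left D_add_right)

lemma curvature_fmult1:
  "\<lbrakk>h \<in> SF; X \<in> VF; Y \<in> VF; Z \<in> VF\<rbrakk> \<Longrightarrow> curvature D (fmult h X) Y Z = fmult h (curvature D X Y Z)"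
  by (simp add: curvature_def bracket_fmult closed D_fmult_left D_fmult_right D_add_left)
    (simp add: fun_eq_iff fmult_def algebra_simps)

lemma curvature_add2:
  "\<lbrakk>X \<in> VF; Y \<in> VF; Y' \<in> VF; Z \<in> VF\<rbrakk> \<Longrightarrow>
    curvature D X (Y + Y') Z = curvature D X Y Z + curvature D X Y' Z"
  by (simp add: curvature_swap[of X] curvature_add1 closed) (simp add: fun_eq_iff fmult_def)

lemma curvature_fmult2:
  "\<lbrakk>h \<in> SF; X \<in> VF; Y \<in> VF; Z \<in> VF\<rbrakk> \<Longrightarrow> curvature D X (fmult h Y) Z = fmult h (curvature D X Y Z)"
  by (simp add: curvature_swap[of X] curvature_fmult1 closed) (simp add: fun_eq_iff fmult_def)

lemma curvature_add3:
  "\<lbrakk>X \<in> VF; Y \<in> VF; Z \<in> VF; Z' \<in> VF\<rbrakk> \<Longrightarrow>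
    curvature D X Y (Z + Z') = curvature D X Y Z + curvature D X Y Z'"
  by (simp add: curvature_def closed D_add_right)

lemma curvature_fmult3:
  assumes "h \<in> SF" "X \<in> VF" "Y \<in> VF" "Z \<in> VF"
  shows "curvature D X Y (fmult h Z) = fmult h (curvature D X Y Z)"
proof -
  \<comment> \<open>The second derivatives of \<open>h\<close> produced by the two iterated
    covariant derivatives are exactly this commutator, which the bracket term of the curvature
    cancels.\<close>
  have "app (bracket X Y) h = (\<lambda>p. X p (app Y h) - Y p (app X h))"
    by (simp add: app_def bracket_def)
  then show ?thesis
    using assms by (simp add: curvature_def closed D_fmult_right D_add_right)
      (simp add: fun_eq_iff fmult_def app_def algebra_simps)
qed

definition nabla_R :: "'g vfield \<Rightarrow> 'g vfield \<Rightarrow> 'g vfield \<Rightarrow> 'g vfield \<Rightarrow> 'g vfield" where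
  "nabla_R W X Y Z = D W (curvature D X Y Z) -
     (curvature D (D W X) Y Z + curvature D X (D W Y) Z + curvature D X Y (D W Z))"

lemma locally_symmetric_iff_nabla_R:
  "locally_symmetric A D \<longleftrightarrow> (\<forall>W\<in>VF. \<forall>X\<in>VF. \<forall>Y\<in>VF. \<forall>Z\<in>VF. nabla_R W X Y Z = 0)"
  by (simp add: locally_symmetric_def nabla_R_def)

text \<open>The frame is orthonormal at every point, so the coefficients are pairings with the
  metric; these are smooth by the definition of a Riemannian metric.\<close>

lemma vector_field_expansion:
  assumes "X \<in> VF" shows "X = (\<Sum>b\<in>Basis. fmult (pair_fields g X (E b)) (E b))"
proof
  fix p
  obtain x where x: "X p = E x p"
    using vector_fieldD(1)[OF assms] by (rule tangentE)
  have sum_at: "(\<Sum>b\<in>B. F b) p = (\<Sum>b\<in>B. F b p)" for B and F :: "'v \<Rightarrow> 'g vfield"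
    by (induction B rule: infinite_finite_induct) simp_all
  have "E x = (\<Sum>b\<in>Basis. E ((x \<bullet> b) *\<^sub>R b))"
    by (simp add: euclidean_representation flip: E_sum)
  then have "E x p = (\<Sum>b\<in>Basis. E ((x \<bullet> b) *\<^sub>R b) p)"
    by (simp only: sum_at)
  moreover have "(\<Sum>b\<in>Basis. fmult (pair_fields g X (E b)) (E b)) p = (\<Sum>b\<in>Basis. E ((x \<bullet> b) *\<^sub>R b) p)"
    by (simp only: sum_at pair_fields_def x E_inner_at fmult_apply E_scale_at)
  ultimately show "X p = (\<Sum>b\<in>Basis. fmult (pair_fields g X (E b)) (E b)) p"
    using x by argo
qed

lemma pair_fields_in: "\<lbrakk>X \<in> VF; Y \<in> VF\<rbrakk> \<Longrightarrow> pair_fields g X Y \<in> SF"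
  using metric by (simp add: riemannian_metric_def)

lemma tensor_zero:
  assumes add: "\<And>X Y. \<lbrakk>X \<in> VF; Y \<in> VF\<rbrakk> \<Longrightarrow> F (X + Y) = F X + F Y"
    and fmult: "\<And>h X. \<lbrakk>h \<in> SF; X \<in> VF\<rbrakk> \<Longrightarrow> F (fmult h X) = fmult h (F X)"
    and zero: "\<And>x. F (E x) = (0 :: 'g vfield)" and X: "X \<in> VF"
  shows "F X = 0"
proof -
  \<comment> \<open>\<open>F\<close> is additive only on \<open>VF\<close>, so membership of the
    partial sums travels with the induction. The empty sum is \<open>E 0\<close>, where
    \<open>zero\<close> applies.\<close>
  have *: "(\<Sum>b\<in>B. fmult (pair_fields g X (E b)) (E b)) \<in> VF \<and>
      F (\<Sum>b\<in>B. fmult (pair_fields g X (E b)) (E b)) = 0" for B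
  proof (induction B rule: infinite_finite_induct)
    case (insert b B)
    have "F (fmult (pair_fields g X (E b)) (E b)) = 0"
      by (simp add: fmult pair_fields_in X E_in zero) (simp add: fmult_def fun_eq_iff)
    then show ?case
      using insert.IH by (simp only: sum.insert[OF insert.hyps] add vector_fields_add
          vector_fields_fmult pair_fields_in X E_in add_0_left simp_thms)
  next
    case (infinite B)
    then show ?case
      using zero[of 0] by (simp only: sum.infinite E_0 vector_fields_zero simp_thms)
  next
    case empty
    then show ?case
      using zero[of 0] by (simp only: sum.empty E_0 vector_fields_zero simp_thms)
  qed
  show ?thesis
    using *[of Basis] vector_field_expansion[OF X] by simp
qed

lemmas tensor_simps = closed D_add_left D_add_right D_fmult_left D_fmult_right
  curvature_add1 curvature_add2 curvature_add3 curvature_fmult1 curvature_fmult2 curvature_fmult3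

lemma nabla_R_zero:
  assumes zero: "\<And>w x y z. nabla_R (E w) (E x) (E y) (E z) = 0"
    and W: "W \<in> VF" and X: "X \<in> VF" and Y: "Y \<in> VF" and Z: "Z \<in> VF"
  shows "nabla_R W X Y Z = 0"
proof -
  \<comment> \<open>The four slots are freed one at a time from the left. In the last three,
    derivatives of the scaling function arise both from differentiating the curvature and from
    differentiating the slot, and they cancel.\<close>
  have 1: "nabla_R W (E x) (E y) (E z) = 0" for x y z
    by (rule tensor_zero[where F="\<lambda>W. nabla_R W (E x) (E y) (E z)", OF _ _ zero W])
      (use W in \<open>simp_all add: nabla_R_def tensor_simps E_in\<close>,
        simp_all add: fun_eq_iff fmult_def algebra_simps)
  have 2: "nabla_R W X (E y) (E z) = 0" for y z
    by (rule tensor_zero[where F="\<lambda>X. nabla_R W X (E y) (E z)", OF _ _ 1 X])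
      (use W X in \<open>simp_all add: nabla_R_def tensor_simps E_in\<close>,
        simp_all add: fun_eq_iff fmult_def algebra_simps)
  have 3: "nabla_R W X Y (E z) = 0" for z
    by (rule tensor_zero[where F="\<lambda>Y. nabla_R W X Y (E z)", OF _ _ 2 Y])
      (use W X Y in \<open>simp_all add: nabla_R_def tensor_simps E_in\<close>,
        simp_all add: fun_eq_iff fmult_def algebra_simps)
  show ?thesis
    by (rule tensor_zero[where F="\<lambda>Z. nabla_R W X Y Z", OF _ _ 3 Z])
      (use W X Y Z in \<open>simp_all add: nabla_R_def tensor_simps E_in\<close>,
        simp_all add: fun_eq_iff fmult_def algebra_simps)
qed

lemma E_inject: "E x = E y \<longleftrightarrow> x = y"
proof
  assume "E x = E y"
  then have "x \<bullet> z = y \<bullet> z" for z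
    using E_inner[of x z] E_inner[of y z] by simp
  then show "x = y"
    using euclidean_eq_iff by blast
qed simp

theorem locally_symmetric_iff:
  "locally_symmetric A D \<longleftrightarrow>
    (\<forall>w x y z. N w (Rm x y z) = Rm (N w x) y z + Rm x (N w y) z + Rm x y (N w z))"
proof -
  have *: "nabla_R (E w) (E x) (E y) (E z) = 0 \<longleftrightarrow>
      N w (Rm x y z) = Rm (N w x) y z + Rm x (N w y) z + Rm x y (N w z)" for w x y z
    by (simp add: nabla_R_def curvature_E D_E flip: E_add E_inject)
  show ?thesis
    unfolding locally_symmetric_iff_nabla_R *[symmetric]
    using E_in(2) by (blast intro: nabla_R_zero)
qed

end


section \<open>Frames from a model Lie algebra\<close>

text \<open>Bracket and inner product are pulled back along \<open>\<Phi>\<close>, so spans and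
  Gram-Schmidt live in the vector space \<open>'w\<close> instead of a set of fields.\<close>

locale lie_model = lie_grp A mul e iv
  for A :: "('g::{t2_space,second_countable_topology}, 'e::euclidean_space) atlas"
    and mul :: "'g \<Rightarrow> 'g \<Rightarrow> 'g" and e :: 'g and iv :: "'g \<Rightarrow> 'g" +
  fixes g :: "'g metric_tensor" and D :: "'g connection"
    and \<Phi> :: "'w::real_vector \<Rightarrow> 'g vfield" and B :: "'w lie_bracket"
  assumes metric: "riemannian_metric A g" and left_invariant: "left_invariant_metric A mul g"
    and levi_civita: "levi_civita A g D"
    and bij: "bij_betw \<Phi> UNIV (lie_algebra A mul)"
    and \<Phi>_add: "\<Phi> (x + y) = \<Phi> x + \<Phi> y"
    and \<Phi>_scale: "\<Phi> (r *\<^sub>R x) = cmult r (\<Phi> x)"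
    and \<Phi>_bracket: "\<Phi> (B x y) = bracket (\<Phi> x) (\<Phi> y)"
    and B: "bilinear B"
begin

definition ip :: "'w \<Rightarrow> 'w \<Rightarrow> real" where
  "ip x y = lie_inner g e (\<Phi> x) (\<Phi> y)"

lemma \<Phi>_inject: "\<Phi> x = \<Phi> y \<longleftrightarrow> x = y"
  using bij by (simp add: bij_betw_def inj_eq)

lemma \<Phi>_range: "range \<Phi> = lie_algebra A mul"
  using bij by (simp add: bij_betw_def)

lemma \<Phi>_in: "\<Phi> x \<in> lie_algebra A mul"
  using \<Phi>_range by auto

lemma \<Phi>_tangent: "\<Phi> x e \<in> tangent_space A e"
  using \<Phi>_in by (auto simp: tangent_space_lie_algebra)

lemma \<Phi>_0: "\<Phi> 0 = 0"
  using \<Phi>_add[of 0 0] by simp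

lemma ip_commute: "ip x y = ip y x"
  and ip_add: "ip (x + y) z = ip x z + ip y z"
  and ip_scale: "ip (r *\<^sub>R x) y = r * ip x y"
  and ip_pos: "x \<noteq> 0 \<Longrightarrow> ip x x > 0"
proof -
  have i: "inner_product_on (tangent_space A e) (g e)"
    using metric by (simp add: riemannian_metric_def)
  show "ip x y = ip y x" "ip (x + y) z = ip x z + ip y z"
    using i \<Phi>_tangent by (simp_all add: inner_product_on_def ip_def lie_inner_def \<Phi>_add)
  show "ip (r *\<^sub>R x) y = r * ip x y"
    using i \<Phi>_tangent by (simp add: inner_product_on_def ip_def lie_inner_def \<Phi>_scale cmult_def)
  assume "x \<noteq> 0"
  \<comment> \<open>The metric at \<open>e\<close> is definite on values, not on fields; a left
    invariant field that vanishes at \<open>e\<close> vanishes everywhere.\<close>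
  have "\<Phi> x e \<noteq> 0"
  proof
    assume 0: "\<Phi> x e = 0"
    have "\<Phi> x p f = 0" for p f
      by (simp add: lie_algebra_translate[OF \<Phi>_in, of x p] 0 push_left_def)
    then have "\<Phi> x = \<Phi> 0" by (simp add: \<Phi>_0 fun_eq_iff)
    then show False using \<open>x \<noteq> 0\<close> by (simp add: \<Phi>_inject)
  qed
  then show "ip x x > 0"
    using i \<Phi>_tangent unfolding inner_product_on_def ip_def lie_inner_def by blast
qed

lemma linear_ip: "linear (\<lambda>x. ip x z)"
  by (rule linearI) (simp_all add: ip_add ip_scale)

lemma ip_add_right: "ip z (x + y) = ip z x + ip z y"
  and ip_scale_right: "ip y (r *\<^sub>R x) = r * ip y x"
  using ip_add[of x y z] ip_scale[of r x y] by (simp_all add: ip_commute)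

text \<open>The equality of spans is what keeps the flag: it later shows which linear functionals
  vanish on which of the new vectors.\<close>

lemma gram_schmidt_step:
  assumes "finite S" and S: "\<And>u v. \<lbrakk>u \<in> S; v \<in> S\<rbrakk> \<Longrightarrow> ip u v = (if u = v then 1 else 0)"
    and v: "v \<notin> span S"
  shows "\<exists>u. ip u u = 1 \<and> (\<forall>w\<in>S. ip u w = 0) \<and> span (insert u S) = span (insert v S)"
proof -
  define s where "s = (\<Sum>w\<in>S. ip v w *\<^sub>R w)"
  define u where "u = (1 / sqrt (ip (v - s) (v - s))) *\<^sub>R (v - s)"
  have s: "s \<in> span S"
    unfolding s_def by (intro span_sum span_scale span_base)
  then have "v - s \<noteq> 0" using v by auto
  then have pos: "ip (v - s) (v - s) > 0" by (rule ip_pos)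
  have "ip (v - s) w = 0" if "w \<in> S" for w
  proof -
    have "ip s w = (\<Sum>w'\<in>S. ip v w' * ip w' w)"
      by (simp add: s_def linear_sum[OF linear_ip] ip_scale)
    also have "\<dots> = (\<Sum>w'\<in>S. if w' = w then ip v w' else 0)"
      by (rule sum.cong) (simp_all add: S that)
    also have "\<dots> = ip v w"
      using \<open>finite S\<close> that by simp
    finally show ?thesis by (simp add: linear_diff[OF linear_ip])
  qed
  then have "\<forall>w\<in>S. ip u w = 0" by (simp add: u_def ip_scale)
  moreover have "ip u u = 1"
    using pos by (simp add: u_def ip_scale ip_scale_right)
  moreover have "span (insert u S) = span (insert v S)"
  proof -
    have s': "s \<in> span (insert x S)" for x
      using s span_mono[of S "insert x S"] by auto
    have "u \<in> span (insert v S)"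
      unfolding u_def by (intro span_scale span_diff s' span_base) simp
    moreover have "v = sqrt (ip (v - s) (v - s)) *\<^sub>R u + s"
      using pos by (simp add: u_def)
    then have "v \<in> span (insert u S)"
      by (metis insertI1 s' span_add span_base span_scale)
    ultimately show ?thesis
      unfolding span_eq by (simp add: span_base subset_iff)
  qed
  ultimately show ?thesis by blast
qed

text \<open>The newest vector comes first in each set, to match \<open>insert u S\<close>. The
  memberships of \<open>h1\<close>, \<open>h2\<close>, \<open>h3\<close> record the flag.\<close>

lemma gram_schmidt4:
  assumes "f1 \<noteq> 0" "f2 \<notin> span {f1}" "f3 \<notin> span {f2, f1}" "f4 \<notin> span {f3, f2, f1}"
    and "span {f4, f3, f2, f1} = UNIV"
  obtains h1 h2 h3 h4 where "ip h1 h1 = 1" "ip h2 h2 = 1" "ip h3 h3 = 1" "ip h4 h4 = 1"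
    "ip h2 h1 = 0" "ip h3 h1 = 0" "ip h3 h2 = 0" "ip h4 h1 = 0" "ip h4 h2 = 0" "ip h4 h3 = 0"
    "h1 \<in> span {f1}" "h2 \<in> span {f2, f1}" "h3 \<in> span {f3, f2, f1}" "span {h4, h3, h2, h1} = UNIV"
proof -
  have span_cong: "span (insert v S) = span (insert v T)" if "span S = span T" for v :: 'w and S T
    using span_Un[of "{v}" S] span_Un[of "{v}" T] that by simp
  obtain h1 where h1: "ip h1 h1 = 1" "span {h1} = span {f1}"
    using gram_schmidt_step[of "{}" f1] assms(1) by auto
  have "f2 \<notin> span {h1}" using assms(2) h1 by simp
  then obtain h2 where h2: "ip h2 h2 = 1" "ip h2 h1 = 0" "span {h2, h1} = span {f2, h1}"
    using gram_schmidt_step[of "{h1}" f2] h1 by auto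
  have s2: "span {h2, h1} = span {f2, f1}"
    using h2(3) span_cong[OF h1(2)] by simp
  have "f3 \<notin> span {h2, h1}" using assms(3) s2 by simp
  then have "\<exists>u. ip u u = 1 \<and> (\<forall>w\<in>{h2, h1}. ip u w = 0) \<and> span {u, h2, h1} = span {f3, h2, h1}"
    by (intro gram_schmidt_step) (use h1(1) h2(1,2) ip_commute in auto)
  then obtain h3 where h3: "ip h3 h3 = 1" "ip h3 h1 = 0" "ip h3 h2 = 0"
    "span {h3, h2, h1} = span {f3, h2, h1}"
    by auto
  have s3: "span {h3, h2, h1} = span {f3, f2, f1}"
    using h3(4) span_cong[OF s2] by simp
  have "f4 \<notin> span {h3, h2, h1}" using assms(4) s3 by simp
  then have "\<exists>u. ip u u = 1 \<and> (\<forall>w\<in>{h3, h2, h1}. ip u w = 0) \<and>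
      span {u, h3, h2, h1} = span {f4, h3, h2, h1}"
    by (intro gram_schmidt_step)
      (use h1(1) h2(1,2) h3(1-3) ip_commute[of h1 h2] ip_commute[of h1 h3] ip_commute[of h2 h3] in auto)
  then obtain h4 where h4: "ip h4 h4 = 1" "ip h4 h1 = 0" "ip h4 h2 = 0" "ip h4 h3 = 0"
    "span {h4, h3, h2, h1} = span {f4, h3, h2, h1}"
    by auto
  have "span {h4, h3, h2, h1} = UNIV"
    using h4(5) span_cong[OF s3] assms(5) by simp
  moreover have "h1 \<in> span {f1}" "h2 \<in> span {f2, f1}" "h3 \<in> span {f3, f2, f1}"
    by (simp_all add: span_base flip: h1(2) s2 s3)
  ultimately show ?thesis
    using that h1 h2 h3 h4 by blast
qed

fun comb :: "'w \<Rightarrow> 'w \<Rightarrow> 'w \<Rightarrow> 'w \<Rightarrow> real \<times> real \<times> real \<times> real \<Rightarrow> 'w" where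
  "comb h1 h2 h3 h4 (x1, x2, x3, x4) = x1 *\<^sub>R h1 + x2 *\<^sub>R h2 + x3 *\<^sub>R h3 + x4 *\<^sub>R h4"

lemma range_comb:
  assumes "span {h1, h2, h3, h4} = UNIV" shows "range (comb h1 h2 h3 h4) = UNIV"
proof -
  have "\<exists>z. w = comb h1 h2 h3 h4 z" for w :: 'w
  proof -
    have "w \<in> span {h1, h2, h3, h4}" by (simp add: assms)
    then obtain x1 x2 x3 x4 where "w - x1 *\<^sub>R h1 - x2 *\<^sub>R h2 - x3 *\<^sub>R h3 - x4 *\<^sub>R h4 = 0"
      by (auto simp: span_breakdown_eq)
    then have "w = comb h1 h2 h3 h4 (x1, x2, x3, x4)"
      by (simp add: algebra_simps)
    then show ?thesis by blast
  qed
  then show ?thesis by (simp add: surj_def del: comb.simps)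
qed

text \<open>The passage from a model to a frame: all that has to be computed is \<open>B\<close> in
  coordinates of an orthonormal basis.\<close>

lemma lie_frame_comb:
  assumes "ip h1 h1 = 1" "ip h2 h2 = 1" "ip h3 h3 = 1" "ip h4 h4 = 1"
    "ip h1 h2 = 0" "ip h1 h3 = 0" "ip h1 h4 = 0" "ip h2 h3 = 0" "ip h2 h4 = 0" "ip h3 h4 = 0"
    and "span {h1, h2, h3, h4} = UNIV"
    and br: "\<And>x y. B (comb h1 h2 h3 h4 x) (comb h1 h2 h3 h4 y) = comb h1 h2 h3 h4 (br x y)"
    and N: "\<And>x y z. 2 * (N x y \<bullet> z) = br x y \<bullet> z - br y z \<bullet> x + br z x \<bullet> y"
  shows "lie_frame A mul e iv g D (\<lambda>x. \<Phi> (comb h1 h2 h3 h4 x)) br N"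
proof
  let ?F = "comb h1 h2 h3 h4"
  show "riemannian_metric A g" "left_invariant_metric A mul g" "Defs.levi_civita A g D"
    by (fact metric left_invariant levi_civita)+
  show "lie_algebra A mul = range (\<lambda>x. \<Phi> (?F x))"
    using image_image[of \<Phi> ?F UNIV] by (simp only: range_comb[OF assms(11)] \<Phi>_range)
  show "\<Phi> (?F (x + y)) = \<Phi> (?F x) + \<Phi> (?F y)" for x y
    by (cases x; cases y) (simp add: algebra_simps flip: \<Phi>_add)
  show "\<Phi> (?F (r *\<^sub>R x)) = cmult r (\<Phi> (?F x))" for r x
    by (cases x) (simp add: algebra_simps flip: \<Phi>_scale)
  show "lie_inner g e (\<Phi> (?F x)) (\<Phi> (?F y)) = x \<bullet> y" for x y
    using assms(1-10) ip_commute[of h2 h1] ip_commute[of h3 h1] ip_commute[of h4 h1]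
      ip_commute[of h3 h2] ip_commute[of h4 h2] ip_commute[of h4 h3]
    by (cases x; cases y)
      (simp add: ip_add ip_add_right ip_scale ip_scale_right inner_Pair algebra_simps flip: ip_def)
  show "bracket (\<Phi> (?F x)) (\<Phi> (?F y)) = \<Phi> (?F (br x y))" for x y
    by (simp add: br flip: \<Phi>_bracket)
  show "2 * (N x y \<bullet> z) = br x y \<bullet> z - br y z \<bullet> x + br z x \<bullet> y" for x y z
    by (rule N)
qed

lemmas B_simps = bilinear_ladd[OF B] bilinear_radd[OF B] bilinear_lmul[OF B] bilinear_rmul[OF B]

end

section \<open>Orthonormal bases of fields versus frames with four coordinates\<close>

lemma sum_1_4: "(\<Sum>i=1..4. f i) = f 1 + f 2 + f 3 + f (4::nat)"
  by (simp add: eval_nat_numeral add.assoc)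

lemma atLeastAtMost_1_4: "{1..4} = {1, 2, 3, 4::nat}"
  by auto

fun unit4 :: "nat \<Rightarrow> real \<times> real \<times> real \<times> real" where
  "unit4 i = (of_bool (i = 1), of_bool (i = 2), of_bool (i = 3), of_bool (i = 4))"

lemma unit4_inner:
  "\<lbrakk>i \<in> {1..4}; j \<in> {1..4}\<rbrakk> \<Longrightarrow> unit4 i \<bullet> unit4 j = (if i = j then 1 else 0)"
  unfolding atLeastAtMost_1_4 by (simp del: One_nat_def) (elim disjE; simp add: inner_Pair)

text \<open>Brings a basis of fields, indexed from 1, back to vectors of the model space. The shift
  \<open>i - 1\<close> is that of list positions, which start at 0.\<close>

lemma (in lie_model) frame_of_orthonormal_basis:
  assumes b: "orthonormal_basis (lie_inner g e) (lie_algebra A mul) 4 b"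
    and C: "structure_constants 4 b C"
  obtains h1 h2 h3 h4 where "ip h1 h1 = 1" "ip h2 h2 = 1" "ip h3 h3 = 1" "ip h4 h4 = 1"
    "ip h1 h2 = 0" "ip h1 h3 = 0" "ip h1 h4 = 0" "ip h2 h3 = 0" "ip h2 h4 = 0" "ip h3 h4 = 0"
    "span {h1, h2, h3, h4} = UNIV"
    "\<And>i j. \<lbrakk>i \<in> {1..4}; j \<in> {1..4}\<rbrakk> \<Longrightarrow> B ([h1, h2, h3, h4] ! (i - 1)) ([h1, h2, h3, h4] ! (j - 1))
       = comb h1 h2 h3 h4 (C i j 1, C i j 2, C i j 3, C i j 4)"
proof -
  define h where "h i = inv \<Phi> (b i)" for i
  have h: "\<Phi> (h i) = b i" if "i \<in> {1..4}" for i
    using b that f_inv_into_f[of "b i" \<Phi> UNIV] \<Phi>_range by (auto simp: orthonormal_basis_def h_def)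
  have ip: "ip (h i) (h j) = (if i = j then 1 else 0)" if "i \<in> {1..4}" "j \<in> {1..4}" for i j
    using b that h by (auto simp: orthonormal_basis_def ip_def)
  have sum: "(\<Sum>i=1..4. cmult (c i) (b i)) = \<Phi> (comb (h 1) (h 2) (h 3) (h 4) (c 1, c 2, c 3, c 4))" for c
    by (simp add: sum_1_4 h \<Phi>_add \<Phi>_scale del: One_nat_def)
  have span: "w \<in> span {h 1, h 2, h 3, h 4}" for w
  proof -
    obtain c where "\<Phi> w = (\<Sum>i=1..4. cmult (c i) (b i))"
      using b \<Phi>_in unfolding orthonormal_basis_def by blast
    then have "w = comb (h 1) (h 2) (h 3) (h 4) (c 1, c 2, c 3, c 4)"
      by (simp only: sum \<Phi>_inject)
    then show ?thesis
      by (simp add: span_add span_scale span_base)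
  qed
  have B_h: "B (h i) (h j) = comb (h 1) (h 2) (h 3) (h 4) (C i j 1, C i j 2, C i j 3, C i j 4)"
    if "i \<in> {1..4}" "j \<in> {1..4}" for i j
  proof -
    have "\<Phi> (B (h i) (h j)) = (\<Sum>k=1..4. cmult (C i j k) (b k))"
      using C that unfolding structure_constants_def by (simp add: \<Phi>_bracket h)
    then show ?thesis by (simp only: sum \<Phi>_inject)
  qed
  have nth: "[h 1, h 2, h 3, h 4] ! (i - 1) = h i" if "i \<in> {1..4}" for i
    using that unfolding atLeastAtMost_1_4 by (auto simp: numeral_eq_Suc)
  show ?thesis
    by (rule that[of "h 1" "h 2" "h 3" "h 4"])
      (use ip nth B_h UNIV_eq_I[OF span] in \<open>simp_all del: One_nat_def comb.simps\<close>)
qed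

lemma sum_unit4:
  assumes "lie_frame A mul e iv g D E br N"
  shows "(\<Sum>i=1..4. cmult (c i) (E (unit4 i))) = E (c 1, c 2, c 3, c 4)"
proof -
  interpret lie_frame A mul e iv g D E br N by fact
  show ?thesis
    by (simp add: sum_1_4 del: One_nat_def flip: E_scale E_add)
qed

lemma orthonormal_basis_of_frame:
  assumes "lie_frame A mul e iv g D E br N"
  shows "orthonormal_basis (lie_inner g e) (lie_algebra A mul) 4 (\<lambda>i. E (unit4 i))"
proof -
  interpret lie_frame A mul e iv g D E br N by fact
  have *: "\<exists>!c. c \<in> {1..4} \<rightarrow>\<^sub>E UNIV \<and> X = (\<Sum>i=1..4. cmult (c i) (E (unit4 i)))"
    if "X \<in> lie_algebra A mul" for X
  proof -
    have "X \<in> range E" using that E_range by simp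
    then obtain x where "X = E x" by (rule imageE)
    moreover obtain x1 x2 x3 x4 where "x = (x1, x2, x3, x4)"
      by (cases x)
    ultimately have X: "X = E (x1, x2, x3, x4)" by simp
    show ?thesis
      unfolding X sum_unit4[OF assms] E_inject
    proof (rule ex1I)
      let ?c = "\<lambda>i\<in>{1..4::nat}. if i = 1 then x1 else if i = 2 then x2 else if i = 3 then x3 else x4"
      show "?c \<in> {1..4} \<rightarrow>\<^sub>E UNIV \<and> (x1, x2, x3, x4) = (?c 1, ?c 2, ?c 3, ?c 4)"
        by simp
      fix c :: "nat \<Rightarrow> real"
      assume c: "c \<in> {1..4} \<rightarrow>\<^sub>E UNIV \<and> (x1, x2, x3, x4) = (c 1, c 2, c 3, c 4)"
      show "c = ?c"
      proof (rule PiE_ext[of c "{1..4}" "\<lambda>_. UNIV"])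
        show "c i = ?c i" if "i \<in> {1..4}" for i
          using that c unfolding atLeastAtMost_1_4 by (simp del: One_nat_def) (elim disjE; simp)
      qed (use c in auto)
    qed
  qed
  show ?thesis
    unfolding orthonormal_basis_def
    by (intro conjI ballI E_in(1) *) (simp_all only: E_inner unit4_inner)
qed


section \<open>The three families\<close>

text \<open>In an orthonormal basis, \<open>br1 a b c\<close> is the bracket with \<open>[e\<^sub>1, e\<^sub>2] = a e\<^sub>1\<close>,
  \<open>[e\<^sub>3, e\<^sub>2] = b e\<^sub>1\<close>, \<open>[e\<^sub>4, e\<^sub>2] = c e\<^sub>1\<close>; \<open>br2 a\<close> has \<open>[e\<^sub>3, e\<^sub>4] = a e\<^sub>1\<close>; and \<open>br3 a\<close> has
  \<open>[e\<^sub>1, e\<^sub>3] = a e\<^sub>1\<close>, \<open>[e\<^sub>2, e\<^sub>3] = a e\<^sub>2\<close>. The products \<open>N1\<close>, \<open>N2\<close>, \<open>N3\<close> are obtained from them by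
  solving Koszul's formula.\<close>

fun br1 :: "real \<Rightarrow> real \<Rightarrow> real \<Rightarrow> real \<times> real \<times> real \<times> real \<Rightarrow> real \<times> real \<times> real \<times> real
    \<Rightarrow> real \<times> real \<times> real \<times> real" where
  "br1 a b c (x1, x2, x3, x4) (y1, y2, y3, y4) =
     ((a * x1 + b * x3 + c * x4) * y2 - x2 * (a * y1 + b * y3 + c * y4), 0, 0, 0)"

fun N1 :: "real \<Rightarrow> real \<Rightarrow> real \<Rightarrow> real \<times> real \<times> real \<times> real \<Rightarrow> real \<times> real \<times> real \<times> real
    \<Rightarrow> real \<times> real \<times> real \<times> real" where
  "N1 a b c (x1, x2, x3, x4) (y1, y2, y3, y4) =
     (((a * x1 + b * x3 + c * x4) * y2 - x2 * (a * y1 + b * y3 + c * y4) + a * (x1 * y2 + y1 * x2)) / 2,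
      - (x1 * (a * y1 + b * y3 + c * y4) + y1 * (a * x1 + b * x3 + c * x4)) / 2,
      b * (x1 * y2 + y1 * x2) / 2,
      c * (x1 * y2 + y1 * x2) / 2)"

lemma N1_koszul:
  "2 * (N1 a b c x y \<bullet> z) = br1 a b c x y \<bullet> z - br1 a b c y z \<bullet> x + br1 a b c z x \<bullet> y"
  by (cases x; cases y; cases z) (simp add: inner_Pair field_simps)

text \<open>The component of \<nabla>R with \<open>w = x = z\<close> the first and \<open>y\<close>
  the second basis vector is (a^2/2)(b e3 + c e4): the terms of third order in \<open>b\<close> and
  \<open>c\<close> occur equally on both sides and cancel.\<close>

lemma locally_symmetric_br1_imp:
  assumes "lie_frame A mul e iv g D E (br1 a b c) (N1 a b c)" "locally_symmetric A D" "a \<noteq> 0"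
  shows "b = 0 \<and> c = 0"
proof -
  interpret lie_frame A mul e iv g D E "br1 a b c" "N1 a b c" by fact
  have "a * (a * b) = 0 \<and> a * (a * c) = 0"
    using locally_symmetric_iff[THEN iffD1, OF assms(2), rule_format,
        of "(1, 0, 0, 0)" "(1, 0, 0, 0)" "(0, 1, 0, 0)" "(1, 0, 0, 0)"]
    by (simp add: Rm_def) (simp add: field_simps)
  then show ?thesis using assms(3) by simp
qed

lemma N1_0:
  "N1 a 0 0 (x1, x2, x3, x4) (y1, y2, y3, y4) = (a * x1 * y2, - a * x1 * y1, 0, 0)"
  by (simp add: algebra_simps)

text \<open>Geometrically a plane of constant curvature -a^2 times a flat plane: the last two basis
  vectors are parallel, and the curvature acts only on the first two.\<close>

lemma locally_symmetric_br1:
  assumes "lie_frame A mul e iv g D E (br1 a 0 0) (N1 a 0 0)"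
  shows "locally_symmetric A D"
proof -
  interpret lie_frame A mul e iv g D E "br1 a 0 0" "N1 a 0 0" by fact
  show ?thesis
    unfolding locally_symmetric_iff Rm_def
    by (simp add: N1_0 zero_prod_def algebra_simps del: N1.simps)
qed

fun br2 :: "real \<Rightarrow> real \<times> real \<times> real \<times> real \<Rightarrow> real \<times> real \<times> real \<times> real
    \<Rightarrow> real \<times> real \<times> real \<times> real" where
  "br2 a (x1, x2, x3, x4) (y1, y2, y3, y4) = (a * (x3 * y4 - x4 * y3), 0, 0, 0)"

fun N2 :: "real \<Rightarrow> real \<times> real \<times> real \<times> real \<Rightarrow> real \<times> real \<times> real \<times> real
    \<Rightarrow> real \<times> real \<times> real \<times> real" where
  "N2 a (x1, x2, x3, x4) (y1, y2, y3, y4) =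
     (a * (x3 * y4 - x4 * y3) / 2, 0, a * (x1 * y4 + y1 * x4) / 2, - a * (x1 * y3 + y1 * x3) / 2)"

lemma N2_koszul:
  "2 * (N2 a x y \<bullet> z) = br2 a x y \<bullet> z - br2 a y z \<bullet> x + br2 a z x \<bullet> y"
  by (cases x; cases y; cases z) (simp add: inner_Pair field_simps)

text \<open>In the component used, the curvature term to be differentiated, \<open>Rm\<close> of e3,
  e4, e1, is 0. The other side is -(a^3/2) e3, with shares -a^3/8 and -3a^3/8 from differentiating
  the second and third arguments.\<close>

lemma locally_symmetric_br2_imp:
  assumes "lie_frame A mul e iv g D E (br2 a) (N2 a)" "locally_symmetric A D"
  shows "a = 0"
proof -
  interpret lie_frame A mul e iv g D E "br2 a" "N2 a" by fact
  show ?thesis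
    using locally_symmetric_iff[THEN iffD1, OF assms(2), rule_format, of "(0, 0, 1, 0)" "(0, 0, 1, 0)" "(0, 0, 0, 1)" "(1, 0, 0, 0)"]
    by (simp add: Rm_def)
qed

fun br3 :: "real \<Rightarrow> real \<times> real \<times> real \<times> real \<Rightarrow> real \<times> real \<times> real \<times> real
    \<Rightarrow> real \<times> real \<times> real \<times> real" where
  "br3 a (x1, x2, x3, x4) (y1, y2, y3, y4) = (a * (x1 * y3 - x3 * y1), a * (x2 * y3 - x3 * y2), 0, 0)"

fun N3 :: "real \<Rightarrow> real \<times> real \<times> real \<times> real \<Rightarrow> real \<times> real \<times> real \<times> real
    \<Rightarrow> real \<times> real \<times> real \<times> real" where
  "N3 a (x1, x2, x3, x4) (y1, y2, y3, y4) = (a * x1 * y3, a * x2 * y3, - a * (x1 * y1 + x2 * y2), 0)"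

lemma N3_koszul:
  "2 * (N3 a x y \<bullet> z) = br3 a x y \<bullet> z - br3 a y z \<bullet> x + br3 a z x \<bullet> y"
  by (cases x; cases y; cases z) (simp add: inner_Pair algebra_simps)

text \<open>Geometrically a three-dimensional space of constant curvature -a^2 times a line. Its
  curvature is built from the metric of the first factor, which is parallel.\<close>

lemma locally_symmetric_br3:
  assumes "lie_frame A mul e iv g D E (br3 a) (N3 a)"
  shows "locally_symmetric A D"
proof -
  interpret lie_frame A mul e iv g D E "br3 a" "N3 a" by fact
  show ?thesis
    unfolding locally_symmetric_iff Rm_def
    by (simp add: zero_prod_def algebra_simps)
qed

section \<open>Adapted orthonormal frames for the model algebras\<close>

lemma lie_model_of_isomorphic:
  assumes "riemannian_lie_group A mul e iv g" "levi_civita A g D" "bilinear B"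
    and "lie_isomorphic (lie_algebra A mul) B"
  obtains \<Phi> where "lie_model A mul e iv g D \<Phi> B"
proof -
  obtain \<Phi> where "bij_betw \<Phi> UNIV (lie_algebra A mul)" "\<forall>x y. \<Phi> (x + y) = \<Phi> x + \<Phi> y"
    "\<forall>r x. \<Phi> (r *\<^sub>R x) = cmult r (\<Phi> x)" "\<forall>x y. \<Phi> (B x y) = bracket (\<Phi> x) (\<Phi> y)"
    using assms(4) unfolding lie_isomorphic_def by blast
  then have "lie_model A mul e iv g D \<Phi> B"
    using assms(1-3) by unfold_locales (simp_all add: riemannian_lie_group_def)
  then show ?thesis by (rule that)
qed

lemma bilinear_models:
  "bilinear (A2 \<oplus>\<^sub>L (A1 \<oplus>\<^sub>L A1))" "bilinear (A31 \<oplus>\<^sub>L A1)" "bilinear (A33 \<oplus>\<^sub>L A1)"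
  unfolding bilinear_def linear_iff
  by (simp_all add: split_paired_all direct_sum_def A1_def A2_def A31_def A33_def algebra_simps)

lemma span_functional_zero:
  fixes \<phi> :: "'w::real_vector \<Rightarrow> real"
  assumes "linear \<phi>" "x \<in> span S" "\<forall>s\<in>S. \<phi> s = 0"
  shows "\<phi> x = 0"
  using linear_eq_0_on_span[OF assms(1) _ assms(2)] assms(3) by blast

context lie_model
begin

lemma ip_0: "ip 0 x = 0"
  using ip_scale[of 0 0 x] by simp

lemma linear_functional_comb:
  assumes "linear \<phi>"
  shows "\<phi> (comb h1 h2 h3 h4 (x1, x2, x3, x4)) = x1 * \<phi> h1 + x2 * \<phi> h2 + x3 * \<phi> h3 + x4 * \<phi> h4"
  by (simp add: linear_add[OF assms] linear_scale[OF assms])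

end

lemma adapted_frame_A2:
  assumes "lie_model A mul e iv g D \<Phi> (A2 \<oplus>\<^sub>L (A1 \<oplus>\<^sub>L A1))"
  obtains E a b c where "lie_frame A mul e iv g D E (br1 a b c) (N1 a b c)" "a > 0"
proof -
  interpret lie_model A mul e iv g D \<Phi> "A2 \<oplus>\<^sub>L (A1 \<oplus>\<^sub>L A1)" by fact
  define \<beta> \<gamma> :: "(real \<times> real) \<times> real \<times> real \<Rightarrow> real" where "\<beta> w = snd (fst w)" and "\<gamma> w = fst (fst w)" for w
  have lin: "linear \<beta>" "linear \<gamma>"
    by (simp_all add: linear_iff \<beta>_def \<gamma>_def)
  \<comment> \<open>\<open>f1\<close> spans the derived algebra, \<open>f2\<close> and
    \<open>f3\<close> are central, and the first three span the kernel of \<open>\<beta>\<close>.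
    With \<open>f4\<close> last, only the last vector after Gram-Schmidt has non-zero
    \<open>\<beta>\<close>.\<close>
  define f1 f2 f3 f4 :: "(real \<times> real) \<times> real \<times> real" where
    f: "f1 = ((1, 0), (0, 0))" "f2 = ((0, 0), (1, 0))" "f3 = ((0, 0), (0, 1))" "f4 = ((0, 1), (0, 0))"
  have bf: "\<beta> f1 = 0" "\<beta> f2 = 0" "\<beta> f3 = 0" "\<beta> f4 = 1" "\<gamma> f1 = 1"
    by (simp_all add: f \<beta>_def \<gamma>_def)
  have br: "(A2 \<oplus>\<^sub>L (A1 \<oplus>\<^sub>L A1)) w w' = (\<gamma> w * \<beta> w' - \<beta> w * \<gamma> w') *\<^sub>R f1" for w w'
    by (cases w; cases w') (auto simp: direct_sum_def A1_def A2_def f \<beta>_def \<gamma>_def)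
  have "f1 \<noteq> 0" "f2 \<notin> span {f1}" "f3 \<notin> span {f2, f1}" "f4 \<notin> span {f3, f2, f1}"
    by (simp_all add: span_breakdown_eq f zero_prod_def)
  moreover have "span {f4, f3, f2, f1} = UNIV"
  proof (rule UNIV_eq_I[symmetric])
    fix w :: "(real \<times> real) \<times> real \<times> real"
    obtain p q r s where "w = ((p, q), (r, s))" by (cases w) auto
    then have "w = q *\<^sub>R f4 + s *\<^sub>R f3 + r *\<^sub>R f2 + p *\<^sub>R f1" by (simp add: f)
    then show "w \<in> span {f4, f3, f2, f1}" by (simp add: span_add span_scale span_base)
  qed
  ultimately obtain h1 h2 h3 h4 where
    h: "ip h1 h1 = 1" "ip h2 h2 = 1" "ip h3 h3 = 1" "ip h4 h4 = 1"
      "ip h2 h1 = 0" "ip h3 h1 = 0" "ip h3 h2 = 0" "ip h4 h1 = 0" "ip h4 h2 = 0" "ip h4 h3 = 0"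
    and sp: "h1 \<in> span {f1}" "h2 \<in> span {f2, f1}" "h3 \<in> span {f3, f2, f1}" "span {h4, h3, h2, h1} = UNIV"
    by (rule gram_schmidt4)
  obtain t where h1: "h1 = t *\<^sub>R f1"
    using sp(1) by (auto simp: span_singleton)
  have t: "t \<noteq> 0" "\<gamma> h1 = t"
    using h(1) by (auto simp: h1 ip_0 linear_scale[OF lin(2)] bf)
  have b0: "\<beta> h1 = 0" "\<beta> h2 = 0" "\<beta> h3 = 0"
    using span_functional_zero[OF lin(1) sp(1)] span_functional_zero[OF lin(1) sp(2)]
      span_functional_zero[OF lin(1) sp(3)] by (simp_all add: bf)
  have b4: "\<beta> h4 \<noteq> 0"
  proof
    assume "\<beta> h4 = 0"
    then have "\<beta> f4 = 0"
      using b0 sp(4) by (intro span_functional_zero[OF lin(1), of f4 "{h4, h3, h2, h1}"]) auto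
    then show False by (simp add: bf)
  qed
  \<comment> \<open>\<open>h1\<close>, \<open>h2\<close>, \<open>h3\<close> span the abelian ideal \<open>ker \<beta>\<close>; the sign of \<open>k\<close> makes \<open>[h1, k]\<close> a positive
    multiple of \<open>h1\<close>.\<close>
  define k where "k = sgn (\<beta> h4) *\<^sub>R h4"
  have k: "\<beta> k > 0" "h4 = sgn (\<beta> h4) *\<^sub>R k" "ip k k = 1"
    using b4 h(4) by (auto simp: k_def linear_scale[OF lin(1)] ip_scale ip_scale_right sgn_real_def)
  have "span {h4, h3, h2, h1} \<subseteq> span {h1, k, h2, h3}"
  proof (rule span_minimal)
    have "h4 \<in> span {h1, k, h2, h3}"
      by (subst k(2)) (simp add: span_scale span_base)
    then show "{h4, h3, h2, h1} \<subseteq> span {h1, k, h2, h3}" by (simp add: span_base)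
  qed simp
  then have spk: "span {h1, k, h2, h3} = UNIV" using sp(4) by blast
  have ipk: "ip h1 k = 0" "ip k h2 = 0" "ip k h3 = 0" "ip h1 h2 = 0" "ip h1 h3 = 0" "ip h2 h3 = 0"
    using h ip_commute[of h1 h4] ip_commute[of h1 h2] ip_commute[of h1 h3] ip_commute[of h2 h3]
    by (simp_all add: k_def ip_scale ip_scale_right)
  \<comment> \<open>In \<open>br\<close> the coordinate \<open>\<gamma> k\<close> cancels by
    skew-symmetry. What remains has coefficients \<open>t\<close>, \<open>\<gamma> h2\<close>,
    \<open>\<gamma> h3\<close> times \<open>\<beta> k\<close>, and \<open>f1 = (1 / t) h1\<close>
    divides each of them by \<open>t\<close>.\<close>
  have "lie_frame A mul e iv g D (\<lambda>x. \<Phi> (comb h1 k h2 h3 x))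
    (br1 (\<beta> k) (\<gamma> h2 * \<beta> k / t) (\<gamma> h3 * \<beta> k / t)) (N1 (\<beta> k) (\<gamma> h2 * \<beta> k / t) (\<gamma> h3 * \<beta> k / t))"
  proof (rule lie_frame_comb[OF h(1) k(3) h(2,3) ipk(1,4,5,2,3,6) spk _ N1_koszul])
    fix x y :: "real \<times> real \<times> real \<times> real"
    obtain x1 x2 x3 x4 y1 y2 y3 y4 where xy: "x = (x1, x2, x3, x4)" "y = (y1, y2, y3, y4)"
      by (cases x; cases y)
    have "f1 = (1 / t) *\<^sub>R h1" using t(1) by (simp add: h1)
    then show "(A2 \<oplus>\<^sub>L (A1 \<oplus>\<^sub>L A1)) (comb h1 k h2 h3 x) (comb h1 k h2 h3 y) =
        comb h1 k h2 h3 (br1 (\<beta> k) (\<gamma> h2 * \<beta> k / t) (\<gamma> h3 * \<beta> k / t) x y)"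
      unfolding xy br linear_functional_comb[OF lin(1)] linear_functional_comb[OF lin(2)]
      using t by (simp add: b0 field_simps)
  qed
  then show ?thesis using k(1) by (rule that)
qed

lemma adapted_frame_A31:
  assumes "lie_model A mul e iv g D \<Phi> (A31 \<oplus>\<^sub>L A1)"
  obtains E a where "lie_frame A mul e iv g D E (br2 a) (N2 a)" "a \<noteq> 0"
proof -
  interpret lie_model A mul e iv g D \<Phi> "A31 \<oplus>\<^sub>L A1" by fact
  define \<beta> \<delta> :: "(real \<times> real \<times> real) \<times> real \<Rightarrow> real"
    where "\<beta> w = fst (snd (fst w))" and "\<delta> w = snd (snd (fst w))" for w
  have lin: "linear \<beta>" "linear \<delta>"
    by (simp_all add: linear_iff \<beta>_def \<delta>_def)
  \<comment> \<open>\<open>f1\<close> spans the derived algebra, and \<open>f1\<close> with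
    \<open>f2\<close> spans the centre. Hence \<open>h1\<close> and \<open>h2\<close> are central,
    and the only bracket left is that of \<open>h3\<close> and \<open>h4\<close>, equal to
    \<open>\<beta> h3 * \<delta> h4 / t\<close> times \<open>h1\<close>.\<close>
  define f1 f2 f3 f4 :: "(real \<times> real \<times> real) \<times> real" where
    f: "f1 = ((1, 0, 0), 0)" "f2 = ((0, 0, 0), 1)" "f3 = ((0, 1, 0), 0)" "f4 = ((0, 0, 1), 0)"
  have bf: "\<beta> f1 = 0" "\<beta> f2 = 0" "\<beta> f3 = 1" "\<beta> f4 = 0" "\<delta> f1 = 0" "\<delta> f2 = 0" "\<delta> f3 = 0" "\<delta> f4 = 1"
    by (simp_all add: f \<beta>_def \<delta>_def)
  have br: "(A31 \<oplus>\<^sub>L A1) w w' = (\<beta> w * \<delta> w' - \<delta> w * \<beta> w') *\<^sub>R f1" for w w'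
    by (cases w; cases w') (auto simp: direct_sum_def A1_def A31_def f \<beta>_def \<delta>_def)
  have "f1 \<noteq> 0" "f2 \<notin> span {f1}" "f3 \<notin> span {f2, f1}" "f4 \<notin> span {f3, f2, f1}"
    by (simp_all add: span_breakdown_eq f zero_prod_def)
  moreover have "span {f4, f3, f2, f1} = UNIV"
  proof (rule UNIV_eq_I[symmetric])
    fix w :: "(real \<times> real \<times> real) \<times> real"
    obtain p q r s where "w = ((p, q, r), s)" by (cases w) auto
    then have "w = r *\<^sub>R f4 + q *\<^sub>R f3 + s *\<^sub>R f2 + p *\<^sub>R f1" by (simp add: f)
    then show "w \<in> span {f4, f3, f2, f1}" by (simp add: span_add span_scale span_base)
  qed
  ultimately obtain h1 h2 h3 h4 where
    h: "ip h1 h1 = 1" "ip h2 h2 = 1" "ip h3 h3 = 1" "ip h4 h4 = 1"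
      "ip h2 h1 = 0" "ip h3 h1 = 0" "ip h3 h2 = 0" "ip h4 h1 = 0" "ip h4 h2 = 0" "ip h4 h3 = 0"
    and sp: "h1 \<in> span {f1}" "h2 \<in> span {f2, f1}" "h3 \<in> span {f3, f2, f1}" "span {h4, h3, h2, h1} = UNIV"
    by (rule gram_schmidt4)
  obtain t where h1: "h1 = t *\<^sub>R f1"
    using sp(1) by (auto simp: span_singleton)
  have t: "t \<noteq> 0"
    using h(1) by (auto simp: h1 ip_0)
  have b0: "\<beta> h1 = 0" "\<beta> h2 = 0" "\<delta> h1 = 0" "\<delta> h2 = 0" "\<delta> h3 = 0"
    using span_functional_zero[OF lin(1) sp(1)] span_functional_zero[OF lin(1) sp(2)]
      span_functional_zero[OF lin(2) sp(1)] span_functional_zero[OF lin(2) sp(2)]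
      span_functional_zero[OF lin(2) sp(3)] by (simp_all add: bf)
  have d4: "\<delta> h4 \<noteq> 0"
  proof
    assume "\<delta> h4 = 0"
    then have "\<delta> f4 = 0"
      using b0 sp(4) by (intro span_functional_zero[OF lin(2), of f4 "{h4, h3, h2, h1}"]) auto
    then show False by (simp add: bf)
  qed
  have b3: "\<beta> h3 \<noteq> 0"
  proof
    assume "\<beta> h3 = 0"
    \<comment> \<open>Otherwise this functional vanishes on all of \<open>h1, \<dots>, h4\<close>, but not on \<open>f3\<close>.\<close>
    moreover have "linear (\<lambda>w. \<delta> h4 * \<beta> w - \<beta> h4 * \<delta> w)"
      by (simp add: linear_iff linear_add[OF lin(1)] linear_add[OF lin(2)] linear_scale[OF lin(1)]
          linear_scale[OF lin(2)] algebra_simps)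
    ultimately have "\<delta> h4 * \<beta> f3 - \<beta> h4 * \<delta> f3 = 0"
      using b0 sp(4)
      by (intro span_functional_zero[where \<phi>="\<lambda>w. \<delta> h4 * \<beta> w - \<beta> h4 * \<delta> w" and S="{h4, h3, h2, h1}"]) auto
    then show False using d4 by (simp add: bf)
  qed
  have "{h1, h2, h3, h4} = {h4, h3, h2, h1}" by auto
  then have sph: "span {h1, h2, h3, h4} = UNIV" using sp(4) by simp
  have iph: "ip h1 h2 = 0" "ip h1 h3 = 0" "ip h1 h4 = 0" "ip h2 h3 = 0" "ip h2 h4 = 0" "ip h3 h4 = 0"
    using h(5-10) ip_commute[of h1 h2] ip_commute[of h1 h3] ip_commute[of h1 h4] ip_commute[of h2 h3]
      ip_commute[of h2 h4] ip_commute[of h3 h4] by simp_all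
  have "lie_frame A mul e iv g D (\<lambda>x. \<Phi> (comb h1 h2 h3 h4 x)) (br2 (\<beta> h3 * \<delta> h4 / t)) (N2 (\<beta> h3 * \<delta> h4 / t))"
  proof (rule lie_frame_comb[OF h(1-4) iph sph _ N2_koszul])
    fix x y :: "real \<times> real \<times> real \<times> real"
    obtain x1 x2 x3 x4 y1 y2 y3 y4 where xy: "x = (x1, x2, x3, x4)" "y = (y1, y2, y3, y4)"
      by (cases x; cases y)
    have "f1 = (1 / t) *\<^sub>R h1" using t by (simp add: h1)
    then show "(A31 \<oplus>\<^sub>L A1) (comb h1 h2 h3 h4 x) (comb h1 h2 h3 h4 y) =
        comb h1 h2 h3 h4 (br2 (\<beta> h3 * \<delta> h4 / t) x y)"
      unfolding xy br linear_functional_comb[OF lin(1)] linear_functional_comb[OF lin(2)]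
      using t by (simp add: b0 field_simps)
  qed
  from that[OF this] show ?thesis using b3 d4 t by simp
qed


section \<open>Frames and prescribed structure constants\<close>

lemma structure_constants_of_frame:
  assumes "lie_frame A mul e iv g D E br N"
    and "\<And>i j. \<lbrakk>i \<in> {1..4}; j \<in> {1..4}\<rbrakk> \<Longrightarrow> br (unit4 i) (unit4 j) = (C i j 1, C i j 2, C i j 3, C i j 4)"
  shows "structure_constants 4 (\<lambda>i. E (unit4 i)) C"
proof -
  interpret lie_frame A mul e iv g D E br N by fact
  show ?thesis
    unfolding structure_constants_def sum_unit4[OF assms(1)] E_bracket
    using assms(2) by simp
qed

text \<open>The structure constants in an orthonormal basis fix the bracket completely, so the model
  bracket \<open>B\<close> can stay arbitrary.\<close>

lemma frame_br1_of_basis: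
  assumes "lie_model A mul e iv g D \<Phi> B"
    and "orthonormal_basis (lie_inner g e) (lie_algebra A mul) 4 b"
    and "structure_constants 4 b (skew (\<lambda>i j k. if (i, j, k) = (1, 2, 1) then a else 0))"
  obtains E where "lie_frame A mul e iv g D E (br1 a 0 0) (N1 a 0 0)"
proof -
  interpret lie_model A mul e iv g D \<Phi> B by fact
  obtain h1 h2 h3 h4 where ip: "ip h1 h1 = 1" "ip h2 h2 = 1" "ip h3 h3 = 1" "ip h4 h4 = 1"
    "ip h1 h2 = 0" "ip h1 h3 = 0" "ip h1 h4 = 0" "ip h2 h3 = 0" "ip h2 h4 = 0" "ip h3 h4 = 0"
    and sp: "span {h1, h2, h3, h4} = UNIV"
    and C: "\<And>i j. \<lbrakk>i \<in> {1..4}; j \<in> {1..4}\<rbrakk> \<Longrightarrow>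
      B ([h1, h2, h3, h4] ! (i - 1)) ([h1, h2, h3, h4] ! (j - 1)) = comb h1 h2 h3 h4
        (let C = skew (\<lambda>i j k. if (i, j, k) = (1, 2, 1) then a else 0)
         in (C i j 1, C i j 2, C i j 3, C i j 4))"
    unfolding Let_def by (rule frame_of_orthonormal_basis[OF assms(2,3)]) blast
  \<comment> \<open>All sixteen brackets of basis vectors; bilinearity of \<open>B\<close> extends
    them to arbitrary coordinates.\<close>
  note Bh = C[of 1 1] C[of 1 2] C[of 1 3] C[of 1 4] C[of 2 1] C[of 2 2] C[of 2 3] C[of 2 4]
    C[of 3 1] C[of 3 2] C[of 3 3] C[of 3 4] C[of 4 1] C[of 4 2] C[of 4 3] C[of 4 4]
  have "B (comb h1 h2 h3 h4 x) (comb h1 h2 h3 h4 y) = comb h1 h2 h3 h4 (br1 a 0 0 x y)" for x y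
    using Bh by (cases x; cases y) (simp add: skew_def B_simps numeral_eq_Suc algebra_simps)
  then show ?thesis
    by (rule that[OF lie_frame_comb[OF ip sp _ N1_koszul]])
qed

lemma frame_br3_of_basis:
  assumes "lie_model A mul e iv g D \<Phi> B"
    and "orthonormal_basis (lie_inner g e) (lie_algebra A mul) 4 b"
    and "structure_constants 4 b
      (skew (\<lambda>i j k. if (i, j, k) = (1, 3, 1) \<or> (i, j, k) = (2, 3, 2) then a else 0))"
  obtains E where "lie_frame A mul e iv g D E (br3 a) (N3 a)"
proof -
  interpret lie_model A mul e iv g D \<Phi> B by fact
  obtain h1 h2 h3 h4 where ip: "ip h1 h1 = 1" "ip h2 h2 = 1" "ip h3 h3 = 1" "ip h4 h4 = 1"
    "ip h1 h2 = 0" "ip h1 h3 = 0" "ip h1 h4 = 0" "ip h2 h3 = 0" "ip h2 h4 = 0" "ip h3 h4 = 0"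
    and sp: "span {h1, h2, h3, h4} = UNIV"
    and C: "\<And>i j. \<lbrakk>i \<in> {1..4}; j \<in> {1..4}\<rbrakk> \<Longrightarrow>
      B ([h1, h2, h3, h4] ! (i - 1)) ([h1, h2, h3, h4] ! (j - 1)) = comb h1 h2 h3 h4
        (let C = skew (\<lambda>i j k. if (i, j, k) = (1, 3, 1) \<or> (i, j, k) = (2, 3, 2) then a else 0)
         in (C i j 1, C i j 2, C i j 3, C i j 4))"
    unfolding Let_def by (rule frame_of_orthonormal_basis[OF assms(2,3)]) blast
  note Bh = C[of 1 1] C[of 1 2] C[of 1 3] C[of 1 4] C[of 2 1] C[of 2 2] C[of 2 3] C[of 2 4]
    C[of 3 1] C[of 3 2] C[of 3 3] C[of 3 4] C[of 4 1] C[of 4 2] C[of 4 3] C[of 4 4]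
  have "B (comb h1 h2 h3 h4 x) (comb h1 h2 h3 h4 y) = comb h1 h2 h3 h4 (br3 a x y)" for x y
    using Bh by (cases x; cases y) (simp add: skew_def B_simps numeral_eq_Suc algebra_simps)
  then show ?thesis
    by (rule that[OF lie_frame_comb[OF ip sp _ N3_koszul]])
qed

theorem theorem1p2:
  fixes A :: "('g::{t2_space,second_countable_topology}, 'e::euclidean_space) atlas"
    and mul :: "'g \<Rightarrow> 'g \<Rightarrow> 'g" and e :: 'g and iv :: "'g \<Rightarrow> 'g"
    and g :: "'g metric_tensor" and D :: "'g connection"
  assumes G: "riemannian_lie_group A mul e iv g"
    and conn: "connected (UNIV :: 'g set)"
    and LC: "levi_civita A g D"
  shows
    "(lie_isomorphic (lie_algebra A mul) (A2 \<oplus>\<^sub>L (A1 \<oplus>\<^sub>L A1)) \<longrightarrow>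
        (locally_symmetric A D \<longleftrightarrow>
          (\<exists>b a. orthonormal_basis (lie_inner g e) (lie_algebra A mul) 4 b \<and> a > 0 \<and>
             structure_constants 4 b
               (skew (\<lambda>i j k. if (i, j, k) = (1, 2, 1) then a else 0))))) \<and>
     (lie_isomorphic (lie_algebra A mul) (A31 \<oplus>\<^sub>L A1) \<longrightarrow> \<not> locally_symmetric A D) \<and>
     (lie_isomorphic (lie_algebra A mul) (A33 \<oplus>\<^sub>L A1) \<longrightarrow>
        (\<exists>b a. orthonormal_basis (lie_inner g e) (lie_algebra A mul) 4 b \<and> a > 0 \<and>
             structure_constants 4 b
               (skew (\<lambda>i j k. if (i, j, k) = (1, 3, 1) \<or> (i, j, k) = (2, 3, 2) then a else 0)))
        \<longrightarrow> locally_symmetric A D)"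
proof (intro conjI impI)
  assume "lie_isomorphic (lie_algebra A mul) (A2 \<oplus>\<^sub>L (A1 \<oplus>\<^sub>L A1))"
  then obtain \<Phi> where model: "lie_model A mul e iv g D \<Phi> (A2 \<oplus>\<^sub>L (A1 \<oplus>\<^sub>L A1))"
    by (rule lie_model_of_isomorphic[OF G LC bilinear_models(1)])
  show "locally_symmetric A D \<longleftrightarrow>
    (\<exists>b a. orthonormal_basis (lie_inner g e) (lie_algebra A mul) 4 b \<and> a > 0 \<and>
      structure_constants 4 b (skew (\<lambda>i j k. if (i, j, k) = (1, 2, 1) then a else 0)))"
  proof
    assume sym: "locally_symmetric A D"
    obtain E a b c where E: "lie_frame A mul e iv g D E (br1 a b c) (N1 a b c)" and a: "a > 0"
      using adapted_frame_A2[OF model] .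
    have "b = 0 \<and> c = 0"
      using locally_symmetric_br1_imp[OF E sym] a by simp
    with E have E: "lie_frame A mul e iv g D E (br1 a 0 0) (N1 a 0 0)" by simp
    have "structure_constants 4 (\<lambda>i. E (unit4 i)) (skew (\<lambda>i j k. if (i, j, k) = (1, 2, 1) then a else 0))"
      by (rule structure_constants_of_frame[OF E]) (auto simp: skew_def)
    then show "\<exists>b a. orthonormal_basis (lie_inner g e) (lie_algebra A mul) 4 b \<and> a > 0 \<and>
      structure_constants 4 b (skew (\<lambda>i j k. if (i, j, k) = (1, 2, 1) then a else 0))"
      using orthonormal_basis_of_frame[OF E] a by blast
  next
    assume "\<exists>b a. orthonormal_basis (lie_inner g e) (lie_algebra A mul) 4 b \<and> a > 0 \<and>
      structure_constants 4 b (skew (\<lambda>i j k. if (i, j, k) = (1, 2, 1) then a else 0))"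
    then obtain b a where "orthonormal_basis (lie_inner g e) (lie_algebra A mul) 4 b"
      "structure_constants 4 b (skew (\<lambda>i j k. if (i, j, k) = (1, 2, 1) then a else 0))" by blast
    then obtain E where "lie_frame A mul e iv g D E (br1 a 0 0) (N1 a 0 0)"
      by (rule frame_br1_of_basis[OF model])
    then show "locally_symmetric A D" by (rule locally_symmetric_br1)
  qed
next
  assume "lie_isomorphic (lie_algebra A mul) (A31 \<oplus>\<^sub>L A1)"
  then obtain \<Phi> where "lie_model A mul e iv g D \<Phi> (A31 \<oplus>\<^sub>L A1)"
    by (rule lie_model_of_isomorphic[OF G LC bilinear_models(2)])
  then obtain E a where "lie_frame A mul e iv g D E (br2 a) (N2 a)" "a \<noteq> 0"
    by (rule adapted_frame_A31)
  then show "\<not> locally_symmetric A D"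
    using locally_symmetric_br2_imp by blast
next
  assume "lie_isomorphic (lie_algebra A mul) (A33 \<oplus>\<^sub>L A1)"
  then obtain \<Phi> where model: "lie_model A mul e iv g D \<Phi> (A33 \<oplus>\<^sub>L A1)"
    by (rule lie_model_of_isomorphic[OF G LC bilinear_models(3)])
  assume "\<exists>b a. orthonormal_basis (lie_inner g e) (lie_algebra A mul) 4 b \<and> a > 0 \<and>
    structure_constants 4 b
      (skew (\<lambda>i j k. if (i, j, k) = (1, 3, 1) \<or> (i, j, k) = (2, 3, 2) then a else 0))"
  then obtain b a where "orthonormal_basis (lie_inner g e) (lie_algebra A mul) 4 b"
    "structure_constants 4 b
      (skew (\<lambda>i j k. if (i, j, k) = (1, 3, 1) \<or> (i, j, k) = (2, 3, 2) then a else 0))" by blast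
  then obtain E where "lie_frame A mul e iv g D E (br3 a) (N3 a)"
    by (rule frame_br3_of_basis[OF model])
  then show "locally_symmetric A D" by (rule locally_symmetric_br3)
qed

end
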